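(* For all $\gamma_0 > -3$ and $\alpha_0 > 0$ there exists an $\varepsilon_0 > 0$ such that for all $\varepsilon \in (0,\varepsilon_0)$ and $\gamma \in (\gamma_0,\infty)$ the system \begin{align*} \partial_t u &= -(1+\partial_x^2)^2 u + \varepsilon^2\alpha_0 u + uv - u^3,\\ \partial_t v &= \partial_x^2 v + \gamma\, \partial_x^2(u^2), \end{align*} with $x\in\mathbb{R}$, $u,v$ real-valued, has stationary periodic solutions of the form \begin{align*} u_{\mathrm{per}}(x) &= 2\varepsilon \sqrt{\frac{\alpha_0 - q_0^2}{3 + \gamma}}\, \cos(k_c (x + x_0)) + \mathcal{O}(\varepsilon^2), \\ v_{\mathrm{per}}(x) &= -2\varepsilon^2\, \frac{(\alpha_0 - q_0^2) \gamma}{3+\gamma} \cos( 2k_c(x+x_0)) + \mathcal{O}(\varepsilon^3), \end{align*} where $x_0 \in [0,2\pi/k_c)$, $k_c^2 = 1 + \varepsilon q_0$ and $q_0 \in (-\sqrt{\alpha_0}, \sqrt{\alpha_0})$. Furthermore, $\int_0^{2\pi/k_c} v_{\mathrm{per}}(x) \, dx = 0$.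
   Context: The system is the Swift-Hohenberg equation with control parameter $\alpha=\varepsilon^2\alpha_0$ coupled to a conservation law with coupling parameter $\gamma$. The number $k_c>0$ is the critical wave number; the solutions are $2\pi/k_c$-periodic in $x$. The $\mathcal{O}$-terms are understood as $\varepsilon\to0$, uniformly in $x$. *)

theory Defs
  imports "HOL-Analysis.Analysis"
begin

definition C_diff :: "nat \<Rightarrow> (real \<Rightarrow> real) \<Rightarrow> bool" where
  "C_diff n f \<longleftrightarrow>
     (\<forall>k<n. \<forall>x. ((deriv ^^ k) f) field_differentiable (at x)) \<and>
     continuous_on UNIV ((deriv ^^ n) f)"

text \<open>The operator \<open>1 + \<partial>\<^sub>x\<^sup>2\<close>.\<close>

definition one_plus_dxx :: "(real \<Rightarrow> real) \<Rightarrow> real \<Rightarrow> real" where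
  "one_plus_dxx f = (\<lambda>x. f x + (deriv ^^ 2) f x)"

text \<open>Classical solutions of the Swift--Hohenberg equation with control parameter \<open>\<alpha>\<close>
  coupled to a conservation law. The arguments of \<open>U\<close> and \<open>V\<close> are time and space, in this order.
  Since \<^term>\<open>deriv\<close> is total, spatial differentiability is demanded explicitly; the
  time derivatives are given by \<open>has_real_derivative\<close>.\<close>

definition solves_SH_cons ::
  "real \<Rightarrow> real \<Rightarrow> (real \<Rightarrow> real \<Rightarrow> real) \<Rightarrow> (real \<Rightarrow> real \<Rightarrow> real) \<Rightarrow> bool" where
  "solves_SH_cons \<alpha> \<gamma> U V \<longleftrightarrow>
     (\<forall>t. C_diff 4 (U t) \<and> C_diff 2 (V t)) \<and>
     (\<forall>t x. ((\<lambda>s. U s x) has_real_derivative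
        (- one_plus_dxx (one_plus_dxx (U t)) x + \<alpha> * U t x + U t x * V t x - U t x ^ 3)) (at t)) \<and>
     (\<forall>t x. ((\<lambda>s. V s x) has_real_derivative
        ((deriv ^^ 2) (V t) x + \<gamma> * (deriv ^^ 2) (\<lambda>y. U t y ^ 2) x)) (at t))"

definition stationary_solution ::
  "real \<Rightarrow> real \<Rightarrow> (real \<Rightarrow> real) \<Rightarrow> (real \<Rightarrow> real) \<Rightarrow> bool" where
  "stationary_solution \<alpha> \<gamma> u v \<longleftrightarrow> solves_SH_cons \<alpha> \<gamma> (\<lambda>t. u) (\<lambda>t. v)"

end

theory Submission
  imports Defs
begin

text \<open>
The second equation is solved by \<open>v = - \<gamma> (u\<^sup>2 - m)\<close> with \<open>m\<close> the mean of \<open>u\<^sup>2\<close>, which also gives \<open>v\<close>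
mean zero. What remains is a nonlocal scalar equation. Put \<open>s = 1 / (3 + \<gamma>)\<close> and
\<open>u x = \<epsilon> sqrt s B w (k (x + x\<^sub>0))\<close>, where \<open>w\<close> is even and \<open>2 pi\<close>-periodic with first cosine
coefficient \<open>1\<close>, and \<open>B\<close> is a number. The equation becomes
\<open>(1 + k\<^sup>2 \<partial>\<^sup>2)\<^sup>2 w = \<epsilon>\<^sup>2 (\<alpha>\<^sub>0 w + B\<^sup>2 N w)\<close> with
\<open>N w = (1 - 3 s) avg (w\<^sup>2) w - (1 - 2 s) w\<^sup>3\<close>. All its coefficients are bounded uniformly for
\<open>\<gamma> > \<gamma>\<^sub>0\<close>.

This is a Lyapunov--Schmidt problem with kernel spanned by \<open>cos\<close>, and evenness removes \<open>sin\<close>. Since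
\<open>1 - k\<^sup>2 = - \<epsilon> q\<^sub>0\<close>, the \<open>cos\<close> component of the equation is \<open>q\<^sub>0\<^sup>2 = \<alpha>\<^sub>0 - B\<^sup>2 D w\<close>, where \<open>- D w\<close> is the
\<open>cos\<close> coefficient of \<open>N w\<close>. It is solved explicitly by \<open>B\<^sup>2 = (\<alpha>\<^sub>0 - q\<^sub>0\<^sup>2) / D w\<close>, without a
bifurcation argument that would degenerate as \<open>q\<^sub>0\<^sup>2\<close> approaches \<open>\<alpha>\<^sub>0\<close>. At \<open>w = cos\<close> one finds
\<open>D w = 1 / 4\<close> (\<open>cubic_coeff_cos\<close>), and this produces the leading order amplitude.

For the complementary component put \<open>w = cos + S (S \<psi>)\<close>, with \<open>S\<close> the inverse of \<open>1 + \<partial>\<^sup>2\<close> on even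
periodic functions without \<open>cos\<close> component. \<open>S\<close> is bounded in the supremum norm
(\<open>inv_helmholtz_bound\<close>) and \<open>S \<psi>\<close> has second derivative \<open>\<psi> - S \<psi>\<close>. The equation for \<open>\<psi>\<close> is a
fixed point equation in which every term has a factor \<open>\<epsilon>\<close>, so it is a contraction on the ball of
radius \<open>\<epsilon>\<close> (\<open>profile_map_fixpoint\<close>). Hence \<open>w\<close> differs from \<open>cos\<close> by a quantity of order \<open>\<epsilon>\<close>, which
gives both expansions (\<open>amplitude_error\<close>, \<open>square_error\<close>).
\<close>

section \<open>Primitives, averages and the first cosine mode\<close>

text \<open>A single primitive on the whole line, normalised at the origin, avoids orientation cases for
integrals over \<open>{0..y}\<close> with \<open>y < 0\<close>. Everything below follows from its derivative and its value
at \<open>0\<close>: two functions with the same derivative and the same value at \<open>0\<close> coincide.\<close>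

definition primitive :: "(real \<Rightarrow> real) \<Rightarrow> real \<Rightarrow> real" where
  "primitive f = (SOME F. F 0 = 0 \<and> (\<forall>x. (F has_real_derivative f x) (at x)))"

lemma
  assumes "continuous_on UNIV f"
  shows primitive_0: "primitive f 0 = 0"
    and primitive_deriv: "(primitive f has_real_derivative f x) (at x)"
proof -
  obtain F where F: "\<And>x. (F has_vector_derivative f x) (at x)"
    using einterval_antiderivative[of "-\<infinity>" "\<infinity>" f] assms
    by (auto simp: continuous_on_eq_continuous_at)
  have "\<exists>F. F 0 = 0 \<and> (\<forall>x. (F has_real_derivative f x) (at x))"
    using F by (intro exI[of _ "\<lambda>x. F x - F 0"])
      (auto simp: has_real_derivative_iff_has_vector_derivative intro!: derivative_eq_intros)
  from someI_ex[OF this, folded primitive_def]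
  show "primitive f 0 = 0" "(primitive f has_real_derivative f x) (at x)" by auto
qed

lemma primitive_deriv' [derivative_intros]:
  assumes "continuous_on UNIV f" "(g has_real_derivative d) (at x within A)"
  shows "((\<lambda>x. primitive f (g x)) has_real_derivative f (g x) * d) (at x within A)"
  using DERIV_chain2[OF primitive_deriv[OF assms(1)] assms(2)] .

lemma continuous_on_primitive:
  assumes "continuous_on UNIV f"
  shows "continuous_on A (primitive f)"
  using primitive_deriv[OF assms] DERIV_isCont continuous_at_imp_continuous_on by blast

lemma deriv_0_imp_eq_at_0:
  fixes h :: "real \<Rightarrow> real"
  assumes "\<And>x. (h has_real_derivative 0) (at x)"
  shows "h x = h 0"
  using DERIV_isconst_all[of h x 0] assms by blast

lemma primitive_eqI:
  assumes "\<And>x. (F has_real_derivative f x) (at x)" "F 0 = 0" "continuous_on UNIV f"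
  shows "primitive f x = F x"
proof -
  have "((\<lambda>x. primitive f x - F x) has_real_derivative 0) (at x)" for x
    by (rule derivative_eq_intros primitive_deriv assms | simp add: assms)+
  from deriv_0_imp_eq_at_0[OF this, of x] show ?thesis using assms primitive_0 by simp
qed

lemma primitive_bound:
  assumes f: "continuous_on UNIV f" and d: "\<And>x. \<bar>f x\<bar> \<le> d"
  shows "\<bar>primitive f y\<bar> \<le> d * \<bar>y\<bar>"
proof -
  have "norm (primitive f y - primitive f 0) \<le> d * norm (y - 0)"
    using primitive_deriv[OF f] d
    by (intro field_differentiable_bound[of UNIV _ f]) (auto intro: has_field_derivative_at_within)
  then show ?thesis using primitive_0[OF f] by simp
qed

lemma primitive_diff:
  assumes "continuous_on UNIV f" "continuous_on UNIV g"
  shows "primitive (\<lambda>x. f x - g x) y = primitive f y - primitive g y"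
  using assms
  by (intro primitive_eqI) (auto intro!: derivative_eq_intros continuous_intros simp: primitive_0)

lemma primitive_scale:
  assumes "continuous_on UNIV f"
  shows "primitive (\<lambda>x. c * f x) y = c * primitive f y"
  using assms
  by (intro primitive_eqI) (auto intro!: derivative_eq_intros continuous_intros simp: primitive_0)

lemma primitive_periodic:
  assumes f: "continuous_on UNIV f" and per: "\<And>x. f (x + p) = f x"
  shows "primitive f (y + p) = primitive f y + primitive f p"
proof -
  have "((\<lambda>y. primitive f (y + p) - primitive f y) has_real_derivative 0) (at y)" for y
    by (rule derivative_eq_intros f refl | simp add: per)+
  from deriv_0_imp_eq_at_0[OF this, of y] show ?thesis using primitive_0[OF f] by simp
qed

lemma primitive_of_even:
  assumes f: "continuous_on UNIV f" and even: "\<And>x. f (-x) = f x"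
  shows "primitive f (-y) = - primitive f y"
proof -
  have "((\<lambda>y. primitive f (-y) + primitive f y) has_real_derivative 0) (at y)" for y
    by (rule derivative_eq_intros f refl | simp add: even)+
  from deriv_0_imp_eq_at_0[OF this, of y] show ?thesis using primitive_0[OF f] by simp
qed

lemma primitive_of_odd:
  assumes f: "continuous_on UNIV f" and odd: "\<And>x. f (-x) = - f x"
  shows "primitive f (-y) = primitive f y"
proof -
  have "((\<lambda>y. primitive f (-y) - primitive f y) has_real_derivative 0) (at y)" for y
    by (rule derivative_eq_intros f refl | simp add: odd)+
  from deriv_0_imp_eq_at_0[OF this, of y] show ?thesis using primitive_0[OF f] by simp
qed

definition avg :: "(real \<Rightarrow> real) \<Rightarrow> real" where
  "avg f = primitive f (2 * pi) / (2 * pi)"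

text \<open>The Fourier coefficient of \<open>cos\<close>; the factor 2 makes it equal to \<open>1\<close> on \<open>cos\<close> itself.\<close>

definition cos_mode :: "(real \<Rightarrow> real) \<Rightarrow> real" where
  "cos_mode f = 2 * avg (\<lambda>x. f x * cos x)"

lemma avg_bound:
  assumes "continuous_on UNIV f" "\<And>x. \<bar>f x\<bar> \<le> d"
  shows "\<bar>avg f\<bar> \<le> d"
  using primitive_bound[OF assms, of "2 * pi"] by (simp add: avg_def divide_simps)

lemma avg_diff:
  assumes "continuous_on UNIV f" "continuous_on UNIV g"
  shows "avg (\<lambda>x. f x - g x) = avg f - avg g"
  using primitive_diff[OF assms] by (simp add: avg_def diff_divide_distrib)

lemma avg_scale:
  assumes "continuous_on UNIV f"
  shows "avg (\<lambda>x. c * f x) = c * avg f"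
  using primitive_scale[OF assms] by (simp add: avg_def)

lemma avg_lipschitz:
  assumes "continuous_on UNIV f" "continuous_on UNIV g" "\<And>x. \<bar>f x - g x\<bar> \<le> d"
  shows "\<bar>avg f - avg g\<bar> \<le> d"
  using avg_bound[of "\<lambda>x. f x - g x" d] assms avg_diff[OF assms(1,2)]
  by (auto intro: continuous_intros)

lemma cos_mode_diff:
  assumes "continuous_on UNIV f" "continuous_on UNIV g"
  shows "cos_mode (\<lambda>x. f x - g x) = cos_mode f - cos_mode g"
  using avg_diff[of "\<lambda>x. f x * cos x" "\<lambda>x. g x * cos x"] assms
  by (simp add: cos_mode_def left_diff_distrib continuous_intros)

lemma cos_mode_scale:
  assumes "continuous_on UNIV f"
  shows "cos_mode (\<lambda>x. c * f x) = c * cos_mode f"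
  using avg_scale[of "\<lambda>x. f x * cos x" c] assms
  by (simp add: cos_mode_def mult.assoc continuous_intros)

lemma cos_mode_add:
  assumes "continuous_on UNIV f" "continuous_on UNIV g"
  shows "cos_mode (\<lambda>x. f x + g x) = cos_mode f + cos_mode g"
  using cos_mode_diff[of "\<lambda>x. f x + g x" g] assms
  by (simp add: continuous_intros)

lemma cos_mode_lipschitz:
  assumes "continuous_on UNIV f" "continuous_on UNIV g" "\<And>x. \<bar>f x - g x\<bar> \<le> d"
  shows "\<bar>cos_mode f - cos_mode g\<bar> \<le> 2 * d"
proof -
  have "\<bar>f x * cos x - g x * cos x\<bar> \<le> d" for x
  proof -
    have "\<bar>f x * cos x - g x * cos x\<bar> = \<bar>f x - g x\<bar> * \<bar>cos x\<bar>"
      by (simp add: abs_mult[symmetric] left_diff_distrib)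
    also have "\<dots> \<le> \<bar>f x - g x\<bar> * 1" by (intro mult_left_mono) auto
    finally show ?thesis using assms(3)[of x] by simp
  qed
  then show ?thesis
    using avg_lipschitz[of "\<lambda>x. f x * cos x" "\<lambda>x. g x * cos x" d] assms
    by (simp add: cos_mode_def continuous_intros)
qed

lemma cos_mode_bound:
  assumes "continuous_on UNIV f" "\<And>x. \<bar>f x\<bar> \<le> d"
  shows "\<bar>cos_mode f\<bar> \<le> 2 * d"
proof -
  have "cos_mode (\<lambda>x. 0) = 0"
    using cos_mode_scale[of "\<lambda>x. 0" 0] by simp
  then show ?thesis
    using cos_mode_lipschitz[of f "\<lambda>x. 0" d] assms by simp
qed

lemma avg_cos_sq: "avg (\<lambda>x. cos x ^ 2) = 1 / 2"
proof -
  have "primitive (\<lambda>x. cos x ^ 2) (2 * pi) = (\<lambda>x. (x + sin x * cos x) / 2) (2 * pi)"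
  proof (rule primitive_eqI)
    fix x :: real
    show "((\<lambda>x. (x + sin x * cos x) / 2) has_real_derivative cos x ^ 2) (at x)"
      by (rule derivative_eq_intros refl | simp)+
        (use sin_cos_squared_add[of x] in algebra)
  qed (auto intro!: continuous_intros)
  then show ?thesis by (simp add: avg_def)
qed

lemma cos_mode_cos: "cos_mode cos = 1"
  using avg_cos_sq by (simp add: cos_mode_def power2_eq_square)

lemma cos_mode_cos_cube: "cos_mode (\<lambda>x. cos x ^ 3) = 3 / 4"
proof -
  have "primitive (\<lambda>x. cos x ^ 3 * cos x) (2 * pi) =
      (\<lambda>x. (3 * x + 3 * sin x * cos x + 2 * sin x * cos x ^ 3) / 8) (2 * pi)"
  proof (rule primitive_eqI)
    fix x :: real
    show "((\<lambda>x. (3 * x + 3 * sin x * cos x + 2 * sin x * cos x ^ 3) / 8) has_real_derivative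
        cos x ^ 3 * cos x) (at x)"
      by (rule derivative_eq_intros refl | simp)+
        (use sin_cos_squared_add[of x] in algebra)
  qed (auto intro!: continuous_intros)
  then show ?thesis by (simp add: cos_mode_def avg_def)
qed

section \<open>Inverting \<open>1 + \<partial>\<^sup>2\<close> away from its kernel\<close>

definition even_periodic :: "(real \<Rightarrow> real) set" where
  "even_periodic = {f. continuous_on UNIV f \<and> (\<forall>x. f (-x) = f x) \<and> (\<forall>x. f (x + 2 * pi) = f x)}"

lemma even_periodicD:
  assumes "f \<in> even_periodic"
  shows "continuous_on A f" "f (-x) = f x" "f (x + 2 * pi) = f x"
  using assms unfolding even_periodic_def by (auto intro: continuous_on_subset)

lemma even_periodic_intros:
  shows "(\<lambda>x. c) \<in> even_periodic" "cos \<in> even_periodic"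
    and "f \<in> even_periodic \<Longrightarrow> g \<in> even_periodic \<Longrightarrow> (\<lambda>x. f x + g x) \<in> even_periodic"
    and "f \<in> even_periodic \<Longrightarrow> g \<in> even_periodic \<Longrightarrow> (\<lambda>x. f x - g x) \<in> even_periodic"
    and "f \<in> even_periodic \<Longrightarrow> g \<in> even_periodic \<Longrightarrow> (\<lambda>x. f x * g x) \<in> even_periodic"
    and "f \<in> even_periodic \<Longrightarrow> (\<lambda>x. f x ^ n) \<in> even_periodic"
  unfolding even_periodic_def by (auto intro!: continuous_intros)

text \<open>Variation of constants: this is \<open>\<integral>\<^sub>0\<^sup>y sin (y - z) f z dz\<close> with the addition theorem
applied, the solution of \<open>p'' + p = f\<close> with \<open>p 0 = p' 0 = 0\<close>.\<close>

definition duhamel :: "(real \<Rightarrow> real) \<Rightarrow> real \<Rightarrow> real" where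
  "duhamel f y = sin y * primitive (\<lambda>z. f z * cos z) y - cos y * primitive (\<lambda>z. f z * sin z) y"

text \<open>Adding a multiple of the kernel element \<open>cos\<close> removes the first cosine mode. The result can
then be inserted into the operator again, as is needed for inverting \<open>(1 + \<partial>\<^sup>2)\<^sup>2\<close>.\<close>

definition inv_helmholtz :: "(real \<Rightarrow> real) \<Rightarrow> real \<Rightarrow> real" where
  "inv_helmholtz f y = duhamel f y - cos_mode (duhamel f) * cos y"

definition inv_helmholtz_deriv :: "(real \<Rightarrow> real) \<Rightarrow> real \<Rightarrow> real" where
  "inv_helmholtz_deriv f y = cos y * primitive (\<lambda>z. f z * cos z) y
     + sin y * primitive (\<lambda>z. f z * sin z) y + cos_mode (duhamel f) * sin y"

lemma continuous_on_duhamel: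
  "continuous_on UNIV f \<Longrightarrow> continuous_on A (duhamel f)"
  unfolding duhamel_def [abs_def]
  by (intro continuous_intros continuous_on_primitive) auto

lemma inv_helmholtz_has_deriv:
  assumes "continuous_on UNIV f"
  shows "(inv_helmholtz f has_real_derivative inv_helmholtz_deriv f y) (at y)"
  unfolding inv_helmholtz_def [abs_def] inv_helmholtz_deriv_def duhamel_def
  using assms by (auto intro!: derivative_eq_intros continuous_intros simp: algebra_simps)

lemma inv_helmholtz_deriv_has_deriv:
  assumes "continuous_on UNIV f"
  shows "(inv_helmholtz_deriv f has_real_derivative f y - inv_helmholtz f y) (at y)"
proof -
  have *: "f y * cos y * cos y + f y * sin y * sin y = f y"
    using sin_cos_squared_add[of y] by algebra
  show ?thesis
    unfolding inv_helmholtz_def inv_helmholtz_deriv_def [abs_def] duhamel_def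
    by (rule derivative_eq_intros refl continuous_intros assms | simp)+
      (use * in \<open>simp add: algebra_simps\<close>)
qed

text \<open>This is the Fredholm alternative for \<open>1 + \<partial>\<^sup>2\<close> on even periodic functions. The solution grows
over a period by the integrals of \<open>f cos\<close> and \<open>f sin\<close>; the first vanishes by assumption and
the second because \<open>f\<close> is even.\<close>

lemma duhamel_even_periodic:
  assumes f: "f \<in> even_periodic" and f0: "cos_mode f = 0"
  shows "duhamel f \<in> even_periodic"
proof -
  note cf = even_periodicD(1)[OF f]
  have cc: "continuous_on UNIV (\<lambda>z. f z * cos z)" "continuous_on UNIV (\<lambda>z. f z * sin z)"
    by (intro continuous_intros cf)+
  have even_c: "primitive (\<lambda>z. f z * cos z) (-y) = - primitive (\<lambda>z. f z * cos z) y" for y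
    by (rule primitive_of_even) (auto simp: cc even_periodicD[OF f])
  have odd_s: "primitive (\<lambda>z. f z * sin z) (-y) = primitive (\<lambda>z. f z * sin z) y" for y
    by (rule primitive_of_odd) (auto simp: cc even_periodicD[OF f])
  have per_c: "primitive (\<lambda>z. f z * cos z) (y + 2 * pi) = primitive (\<lambda>z. f z * cos z) y" for y
    using primitive_periodic[of "\<lambda>z. f z * cos z" "2 * pi" y] f0
    by (simp add: cc even_periodicD[OF f] cos_mode_def avg_def)
  have step_s: "primitive (\<lambda>z. f z * sin z) (y + 2 * pi) =
      primitive (\<lambda>z. f z * sin z) y + primitive (\<lambda>z. f z * sin z) (2 * pi)" for y
    by (rule primitive_periodic) (auto simp: cc even_periodicD[OF f])
  \<comment> \<open>A primitive of the odd function \<open>f sin\<close> is even, so its values at \<open>-pi\<close> and \<open>pi\<close> agree.\<close>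
  have per_s: "primitive (\<lambda>z. f z * sin z) (y + 2 * pi) = primitive (\<lambda>z. f z * sin z) y" for y
    using step_s[of "- pi"] step_s[of y] odd_s[of pi] by simp
  show ?thesis
    unfolding even_periodic_def
    by (auto simp: continuous_on_duhamel cf) (auto simp: duhamel_def even_c odd_s per_c per_s)
qed

lemma inv_helmholtz_even_periodic:
  assumes "f \<in> even_periodic" "cos_mode f = 0"
  shows "inv_helmholtz f \<in> even_periodic"
  unfolding inv_helmholtz_def [abs_def]
  by (intro even_periodic_intros duhamel_even_periodic assms)

lemma cos_mode_inv_helmholtz:
  assumes "continuous_on UNIV f"
  shows "cos_mode (inv_helmholtz f) = 0"
  unfolding inv_helmholtz_def [abs_def]
  using assms
  by (simp add: cos_mode_diff cos_mode_scale cos_mode_cos continuous_on_duhamel continuous_intros)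

lemma duhamel_diff:
  assumes "continuous_on UNIV f" "continuous_on UNIV g"
  shows "duhamel (\<lambda>x. f x - g x) y = duhamel f y - duhamel g y"
  using assms
  by (simp add: duhamel_def left_diff_distrib primitive_diff continuous_intros) (simp add: algebra_simps)

lemma even_periodic_bounded_by_period:
  assumes "f \<in> even_periodic" "\<And>x. 0 \<le> x \<Longrightarrow> x \<le> 2 * pi \<Longrightarrow> \<bar>f x\<bar> \<le> d"
  shows "\<bar>f x\<bar> \<le> d"
proof -
  have per: "f (x + 2 * pi * of_int n) = f x" for x n
  proof -
    have nat: "f (x + 2 * pi * of_nat m) = f x" for m x
    proof (induction m)
      case (Suc m)
      show ?case
        using even_periodicD(3)[OF assms(1), of "x + 2 * pi * of_nat m"] Suc
        by (simp add: algebra_simps)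
    qed simp
    show ?thesis
    proof (cases "n \<ge> 0")
      case True
      then show ?thesis using nat[of x "nat n"] by simp
    next
      case False
      then show ?thesis using nat[of "x + 2 * pi * of_int n" "nat (-n)"] by simp
    qed
  qed
  define n where "n = \<lfloor>x / (2 * pi)\<rfloor>"
  have "of_int n \<le> x / (2 * pi)" "x / (2 * pi) < of_int n + 1"
    unfolding n_def by linarith+
  then have "0 \<le> x - 2 * pi * of_int n" "x - 2 * pi * of_int n \<le> 2 * pi"
    by (auto simp: field_simps)
  from assms(2)[OF this] show ?thesis
    using per[of x "-n"] by simp
qed

text \<open>On one period both integrals are at most \<open>2 pi d \<le> 8 d\<close>; periodicity carries the bound to the line.\<close>

lemma duhamel_bound:
  assumes f: "f \<in> even_periodic" "cos_mode f = 0" and d: "\<And>x. \<bar>f x\<bar> \<le> d"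
  shows "\<bar>duhamel f y\<bar> \<le> 16 * d"
proof (rule even_periodic_bounded_by_period[OF duhamel_even_periodic[OF f]])
  fix y :: real assume y: "0 \<le> y" "y \<le> 2 * pi"
  note cf = even_periodicD(1)[OF f(1)]
  have d0: "0 \<le> d" using d[of 0] by linarith
  have le: "\<bar>a * b\<bar> \<le> c" if "\<bar>a\<bar> \<le> c" "\<bar>b\<bar> \<le> 1" for a b c :: real
    using mult_mono[of "\<bar>a\<bar>" c "\<bar>b\<bar>" 1] that by (simp add: abs_mult)
  have y8: "d * \<bar>y\<bar> \<le> d * 8"
    using y pi_less_4 by (intro mult_left_mono d0) simp
  have "\<bar>primitive (\<lambda>z. f z * cos z) y\<bar> \<le> d * 8" "\<bar>primitive (\<lambda>z. f z * sin z) y\<bar> \<le> d * 8"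
    by (rule order_trans[OF primitive_bound y8]; intro continuous_intros cf le d; simp)+
  then have "\<bar>primitive (\<lambda>z. f z * cos z) y * sin y\<bar> \<le> d * 8"
      "\<bar>primitive (\<lambda>z. f z * sin z) y * cos y\<bar> \<le> d * 8"
    by (auto intro!: le)
  then show "\<bar>duhamel f y\<bar> \<le> 16 * d"
    unfolding duhamel_def by (simp add: mult.commute)
qed

lemma inv_helmholtz_bound:
  assumes f: "f \<in> even_periodic" "cos_mode f = 0" and d: "\<And>x. \<bar>f x\<bar> \<le> d"
  shows "\<bar>inv_helmholtz f y\<bar> \<le> 48 * d"
proof -
  note b = duhamel_bound[OF f d]
  have d0: "0 \<le> d" using d[of 0] by linarith
  have "\<bar>cos_mode (duhamel f)\<bar> \<le> 2 * (16 * d)"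
    by (intro cos_mode_bound b continuous_on_duhamel even_periodicD(1)[OF f(1)])
  then have "\<bar>cos_mode (duhamel f) * cos y\<bar> \<le> 32 * d"
    using mult_mono[of "\<bar>cos_mode (duhamel f)\<bar>" "32 * d" "\<bar>cos y\<bar>" 1] d0
    by (simp add: abs_mult)
  then show ?thesis using b[of y] unfolding inv_helmholtz_def by linarith
qed

lemma inv_helmholtz_lipschitz:
  assumes f: "f \<in> even_periodic" "cos_mode f = 0" and g: "g \<in> even_periodic" "cos_mode g = 0"
    and d: "\<And>x. \<bar>f x - g x\<bar> \<le> d"
  shows "\<bar>inv_helmholtz f y - inv_helmholtz g y\<bar> \<le> 48 * d"
proof -
  note c = even_periodicD(1)[OF f(1)] even_periodicD(1)[OF g(1)]
  have "duhamel (\<lambda>x. f x - g x) = (\<lambda>y. duhamel f y - duhamel g y)"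
    by (intro ext duhamel_diff c)
  then have "cos_mode (duhamel (\<lambda>x. f x - g x)) = cos_mode (duhamel f) - cos_mode (duhamel g)"
    by (simp add: cos_mode_diff continuous_on_duhamel c)
  then have "inv_helmholtz (\<lambda>x. f x - g x) y = inv_helmholtz f y - inv_helmholtz g y"
    by (simp add: inv_helmholtz_def duhamel_diff[OF c]) (simp add: left_diff_distrib)
  moreover have "\<bar>inv_helmholtz (\<lambda>x. f x - g x) y\<bar> \<le> 48 * d"
    by (rule inv_helmholtz_bound) (auto simp: cos_mode_diff c f g d intro!: even_periodic_intros)
  ultimately show ?thesis by simp
qed

text \<open>The contraction principle in terms of ordinary functions and pointwise bounds: the hypotheses make
the functions in \<open>A\<close> a closed subset of the complete space of bounded continuous functions, on
which \<open>G\<close> contracts the supremum distance.\<close>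

lemma uniform_contraction_fixpoint:
  fixes A :: "('a::metric_space \<Rightarrow> real) set"
  assumes nonempty: "A \<noteq> {}"
    and cont: "\<And>f. f \<in> A \<Longrightarrow> continuous_on UNIV f"
    and bdd: "\<And>f x. f \<in> A \<Longrightarrow> \<bar>f x\<bar> \<le> r"
    and closed: "\<And>f. continuous_on UNIV f \<Longrightarrow> (\<And>d. d > 0 \<Longrightarrow> \<exists>g\<in>A. \<forall>x. \<bar>g x - f x\<bar> \<le> d) \<Longrightarrow> f \<in> A"
    and maps: "\<And>f. f \<in> A \<Longrightarrow> G f \<in> A"
    and contraction: "\<And>f g d x. f \<in> A \<Longrightarrow> g \<in> A \<Longrightarrow> (\<And>x. \<bar>f x - g x\<bar> \<le> d) \<Longrightarrow> \<bar>G f x - G g x\<bar> \<le> c * d"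
    and c: "0 \<le> c" "c < 1"
  shows "\<exists>f\<in>A. G f = f"
proof -
  define S where "S = {F :: 'a \<Rightarrow>\<^sub>C real. apply_bcontfun F \<in> A}"
  have mem: "f \<in> bcontfun" if "f \<in> A" for f
    using that cont bdd by (intro bcontfun_normI) auto
  have app: "apply_bcontfun (Bcontfun f) = f" if "f \<in> A" for f
    using mem[OF that] by (rule Bcontfun_inverse)
  have "F \<in> S" if "F \<in> closure S" for F
  proof -
    have "\<exists>g\<in>A. \<forall>x. \<bar>g x - apply_bcontfun F x\<bar> \<le> d" if "d > 0" for d
    proof -
      obtain H where "H \<in> S" "dist H F < d"
        using \<open>F \<in> closure S\<close> \<open>d > 0\<close> by (auto simp: closure_approachable)
      then show ?thesis
        using dist_fun_lt_imp_dist_val_lt[of H F d]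
        by (intro bexI[of _ "apply_bcontfun H"]) (auto simp: S_def dist_real_def less_imp_le)
    qed
    then show ?thesis by (auto simp: S_def intro: closed)
  qed
  then have "complete S"
    using closure_subset_eq[of S] by (auto simp: complete_eq_closed)
  moreover have "S \<noteq> {}"
  proof -
    obtain f where "f \<in> A" using nonempty by blast
    then have "Bcontfun f \<in> S" by (simp add: S_def app)
    then show ?thesis by blast
  qed
  moreover have "(\<lambda>F. Bcontfun (G (apply_bcontfun F))) ` S \<subseteq> S"
    using maps app by (auto simp: S_def)
  moreover have "dist (Bcontfun (G (apply_bcontfun F))) (Bcontfun (G (apply_bcontfun H))) \<le> c * dist F H"
    if "F \<in> S" "H \<in> S" for F H
  proof (rule dist_bound)
    fix x
    have *: "apply_bcontfun F \<in> A" "apply_bcontfun H \<in> A" using that by (auto simp: S_def)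
    have "\<bar>apply_bcontfun F x - apply_bcontfun H x\<bar> \<le> dist F H" for x
      using dist_bounded[of F x H] by (simp add: dist_real_def)
    from contraction[OF * this, of x]
    show "dist (apply_bcontfun (Bcontfun (G (apply_bcontfun F))) x)
        (apply_bcontfun (Bcontfun (G (apply_bcontfun H))) x) \<le> c * dist F H"
      using * by (simp add: app maps dist_real_def)
  qed
  ultimately obtain F where "F \<in> S" "Bcontfun (G (apply_bcontfun F)) = F"
    using Banach_fix[of S c "\<lambda>F. Bcontfun (G (apply_bcontfun F))"] c by blast
  then have F: "apply_bcontfun F \<in> A" by (simp add: S_def)
  have "G (apply_bcontfun F) = apply_bcontfun F"
    using app[OF maps[OF F]] \<open>Bcontfun (G (apply_bcontfun F)) = F\<close> by simp
  with F show ?thesis by blast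
qed

definition perp_ball :: "real \<Rightarrow> (real \<Rightarrow> real) set" where
  "perp_ball r = {f \<in> even_periodic. cos_mode f = 0 \<and> (\<forall>x. \<bar>f x\<bar> \<le> r)}"

text \<open>Evenness, periodicity and the vanishing of the first mode are equations between quantities that are
Lipschitz in the supremum norm, so they survive uniform limits.\<close>

lemma perp_ball_closed:
  assumes f: "continuous_on UNIV f"
    and lim: "\<And>d. d > 0 \<Longrightarrow> \<exists>g\<in>perp_ball r. \<forall>x. \<bar>g x - f x\<bar> \<le> d"
  shows "f \<in> perp_ball r"
proof -
  have eq: "a = b" if "\<And>d. d > 0 \<Longrightarrow> \<bar>a - b\<bar> \<le> 2 * d" for a b :: real
  proof (rule ccontr)
    assume "a \<noteq> b"
    then have "\<bar>a - b\<bar> > 0" by simp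
    with that[of "\<bar>a - b\<bar> / 4"] show False by (simp add: field_simps)
  qed
  have "f (-x) = f x" for x
  proof (rule eq)
    fix d :: real assume "d > 0"
    from lim[OF this] obtain g where "g \<in> even_periodic" "\<And>x. \<bar>g x - f x\<bar> \<le> d"
      by (auto simp: perp_ball_def)
    from this(2)[of x] this(2)[of "-x"] even_periodicD(2)[OF this(1), of x]
    show "\<bar>f (-x) - f x\<bar> \<le> 2 * d" by linarith
  qed
  moreover have "f (x + 2 * pi) = f x" for x
  proof (rule eq)
    fix d :: real assume "d > 0"
    from lim[OF this] obtain g where "g \<in> even_periodic" "\<And>x. \<bar>g x - f x\<bar> \<le> d"
      by (auto simp: perp_ball_def)
    from this(2)[of x] this(2)[of "x + 2 * pi"] even_periodicD(3)[OF this(1), of x]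
    show "\<bar>f (x + 2 * pi) - f x\<bar> \<le> 2 * d" by linarith
  qed
  moreover have "cos_mode f = 0"
  proof (rule eq)
    fix d :: real assume "d > 0"
    from lim[OF this] obtain g where g: "g \<in> even_periodic" "cos_mode g = 0" "\<And>x. \<bar>g x - f x\<bar> \<le> d"
      by (auto simp: perp_ball_def)
    then show "\<bar>cos_mode f - 0\<bar> \<le> 2 * d"
      using cos_mode_lipschitz[OF even_periodicD(1)[OF g(1)] f g(3)] by simp
  qed
  moreover have "\<bar>f x\<bar> \<le> r" for x
  proof (rule field_le_epsilon)
    fix d :: real assume "d > 0"
    from lim[OF this] obtain g where "\<And>x. \<bar>g x\<bar> \<le> r" "\<And>x. \<bar>g x - f x\<bar> \<le> d"
      by (auto simp: perp_ball_def)
    from this(1)[of x] this(2)[of x] show "\<bar>f x\<bar> \<le> r + d" by linarith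
  qed
  ultimately show ?thesis using f by (auto simp: perp_ball_def even_periodic_def)
qed

section \<open>The cubic nonlinearity\<close>

text \<open>Up to its sign, this is the first mode of \<open>cubic_term\<close> for a function \<open>w\<close> whose own first mode
is \<open>1\<close>.\<close>

definition cubic_coeff :: "real \<Rightarrow> real \<Rightarrow> (real \<Rightarrow> real) \<Rightarrow> real" where
  "cubic_coeff a b w = a * cos_mode (\<lambda>x. w x ^ 3) - b * avg (\<lambda>x. w x ^ 2)"

text \<open>Eliminating \<open>v\<close> turns the nonlinear part \<open>u v - u\<^sup>3\<close> into this nonlocal cubic expression. With
\<open>s = 1 / (3 + \<gamma>)\<close> absorbed in the amplitude, its coefficients become \<open>a = (1 + \<gamma>) s = 1 - 2 s\<close> and
\<open>b = \<gamma> s = 1 - 3 s\<close>. They stay bounded as \<open>\<gamma>\<close> tends to infinity.\<close>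

definition cubic_term :: "real \<Rightarrow> real \<Rightarrow> (real \<Rightarrow> real) \<Rightarrow> real \<Rightarrow> real" where
  "cubic_term a b w x = b * avg (\<lambda>x. w x ^ 2) * w x - a * w x ^ 3"

text \<open>The square of the amplitude is not an unknown: \<open>\<kappa> / cubic_coeff a b w\<close> is the value for which, when
\<open>w\<close> has first mode \<open>1\<close>, the right-hand side has first mode \<open>\<alpha> - \<kappa>\<close> (see \<open>cos_mode_reaction\<close>), so the solvability
condition is built into the equation.\<close>

definition reaction :: "real \<Rightarrow> real \<Rightarrow> real \<Rightarrow> real \<Rightarrow> (real \<Rightarrow> real) \<Rightarrow> real \<Rightarrow> real" where
  "reaction \<alpha> \<kappa> a b w x = \<alpha> * w x + \<kappa> / cubic_coeff a b w * cubic_term a b w x"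

lemma abs_mult_le:
  fixes x y :: real
  assumes "\<bar>x\<bar> \<le> a" "\<bar>y\<bar> \<le> b"
  shows "\<bar>x * y\<bar> \<le> a * b"
  using assms by (simp add: abs_mult mult_mono')

lemma abs_mult_diff_le:
  fixes x y :: real
  assumes "\<bar>x - x'\<bar> \<le> dx" "\<bar>y\<bar> \<le> b" "\<bar>x'\<bar> \<le> a" "\<bar>y - y'\<bar> \<le> dy"
  shows "\<bar>x * y - x' * y'\<bar> \<le> dx * b + a * dy"
proof -
  have "x * y - x' * y' = (x - x') * y + x' * (y - y')" by algebra
  then show ?thesis
    using abs_mult_le[OF assms(1,2)] abs_mult_le[OF assms(3,4)] by linarith
qed

lemma abs_square_diff_le:
  fixes x y :: real
  assumes "\<bar>x\<bar> \<le> 2" "\<bar>y\<bar> \<le> 2" "\<bar>x - y\<bar> \<le> d"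
  shows "\<bar>x ^ 2 - y ^ 2\<bar> \<le> 4 * d"
  using abs_mult_diff_le[OF assms(3,1,2,3)] by (simp add: power2_eq_square)

lemma abs_cube_diff_le:
  fixes x y :: real
  assumes "\<bar>x\<bar> \<le> 2" "\<bar>y\<bar> \<le> 2" "\<bar>x - y\<bar> \<le> d"
  shows "\<bar>x ^ 3 - y ^ 3\<bar> \<le> 12 * d"
proof -
  have "\<bar>y ^ 2\<bar> \<le> 4" using abs_mult_le[OF assms(2,2)] by (simp add: power2_eq_square)
  from abs_mult_diff_le[OF abs_square_diff_le[OF assms] assms(1) this assms(3)]
  show ?thesis by (simp add: power2_eq_square power3_eq_cube)
qed

lemma cubic_coeff_lipschitz:
  assumes ab: "\<bar>a\<bar> \<le> K" "\<bar>b\<bar> \<le> K"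
    and c: "continuous_on UNIV w" "continuous_on UNIV w'"
    and w: "\<And>x. \<bar>w x\<bar> \<le> 2" "\<And>x. \<bar>w' x\<bar> \<le> 2"
    and d: "\<And>x. \<bar>w x - w' x\<bar> \<le> d"
  shows "\<bar>cubic_coeff a b w - cubic_coeff a b w'\<bar> \<le> 28 * K * d"
proof -
  have 1: "\<bar>cos_mode (\<lambda>x. w x ^ 3) - cos_mode (\<lambda>x. w' x ^ 3)\<bar> \<le> 2 * (12 * d)"
    by (intro cos_mode_lipschitz abs_cube_diff_le continuous_intros c w d)
  have 2: "\<bar>avg (\<lambda>x. w x ^ 2) - avg (\<lambda>x. w' x ^ 2)\<bar> \<le> 4 * d"
    by (intro avg_lipschitz abs_square_diff_le continuous_intros c w d)
  have "\<bar>a * (cos_mode (\<lambda>x. w x ^ 3) - cos_mode (\<lambda>x. w' x ^ 3))\<bar> \<le> K * (2 * (12 * d))"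
    "\<bar>b * (avg (\<lambda>x. w x ^ 2) - avg (\<lambda>x. w' x ^ 2))\<bar> \<le> K * (4 * d)"
    by (rule abs_mult_le ab 1 2)+
  then show ?thesis by (simp add: cubic_coeff_def right_diff_distrib)
qed

lemma avg_square_bound:
  assumes "continuous_on UNIV w" "\<And>x. \<bar>w x\<bar> \<le> 2"
  shows "\<bar>avg (\<lambda>x. w x ^ 2)\<bar> \<le> 4"
proof (rule avg_bound)
  show "\<bar>w x ^ 2\<bar> \<le> 4" for x
    using abs_mult_le[OF assms(2,2), of x x] by (simp add: power2_eq_square)
qed (intro continuous_intros assms)

lemma cubic_term_bound:
  assumes ab: "\<bar>a\<bar> \<le> K" "\<bar>b\<bar> \<le> K" and w: "continuous_on UNIV w" "\<And>x. \<bar>w x\<bar> \<le> 2"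
  shows "\<bar>cubic_term a b w x\<bar> \<le> 16 * K"
proof -
  have "\<bar>b * avg (\<lambda>x. w x ^ 2) * w x\<bar> \<le> K * 4 * 2"
    by (intro abs_mult_le ab avg_square_bound w)
  moreover have "\<bar>a * (w x * w x * w x)\<bar> \<le> K * (2 * 2 * 2)"
    by (intro abs_mult_le ab w)
  ultimately show ?thesis by (simp add: cubic_term_def power3_eq_cube)
qed

lemma cubic_term_lipschitz:
  assumes ab: "\<bar>a\<bar> \<le> K" "\<bar>b\<bar> \<le> K"
    and c: "continuous_on UNIV w" "continuous_on UNIV w'"
    and w: "\<And>x. \<bar>w x\<bar> \<le> 2" "\<And>x. \<bar>w' x\<bar> \<le> 2"
    and d: "\<And>x. \<bar>w x - w' x\<bar> \<le> d"
  shows "\<bar>cubic_term a b w x - cubic_term a b w' x\<bar> \<le> 24 * K * d"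
proof -
  have 1: "\<bar>avg (\<lambda>x. w x ^ 2) - avg (\<lambda>x. w' x ^ 2)\<bar> \<le> 4 * d"
    by (intro avg_lipschitz abs_square_diff_le continuous_intros c w d)
  have "\<bar>avg (\<lambda>x. w x ^ 2) * w x - avg (\<lambda>x. w' x ^ 2) * w' x\<bar> \<le> 4 * d * 2 + 4 * d"
    by (intro abs_mult_diff_le avg_square_bound c w d 1)
  from abs_mult_le[OF ab(2) this] abs_mult_le[OF ab(1) abs_cube_diff_le[OF w d], of x]
  show ?thesis by (simp add: cubic_term_def right_diff_distrib mult.assoc)
qed

lemma abs_divide_le_8:
  fixes D :: real
  assumes "0 \<le> \<kappa>" "\<kappa> \<le> \<alpha>" "D \<ge> 1 / 8"
  shows "\<bar>\<kappa> / D\<bar> \<le> \<alpha> * 8"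
proof -
  have "\<kappa> / D \<le> \<alpha> / (1 / 8)" by (intro frac_le) (use assms in auto)
  moreover have "0 \<le> \<kappa> / D" using assms by simp
  ultimately show ?thesis by simp
qed

lemma abs_divide_diff_le:
  fixes D D' :: real
  assumes "0 \<le> \<kappa>" "\<kappa> \<le> \<alpha>" "D \<ge> 1 / 8" "D' \<ge> 1 / 8" "\<bar>D - D'\<bar> \<le> e"
  shows "\<bar>\<kappa> / D - \<kappa> / D'\<bar> \<le> \<alpha> * 8 * (e * 8)"
proof -
  have "\<kappa> / D - \<kappa> / D' = \<kappa> / D * ((D' - D) * (1 / D'))"
    using assms by (simp add: divide_simps) (simp add: algebra_simps)
  moreover have "\<bar>\<kappa> / D * ((D' - D) * (1 / D'))\<bar> \<le> \<alpha> * 8 * (e * (1 * 8))"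
    using assms by (intro abs_mult_le abs_divide_le_8) (auto simp: abs_minus_commute)
  ultimately show ?thesis by simp
qed

lemma reaction_bound:
  assumes ab: "\<bar>a\<bar> \<le> K" "\<bar>b\<bar> \<le> K" and \<kappa>: "0 \<le> \<kappa>" "\<kappa> \<le> \<alpha>" and K: "1 \<le> K"
    and w: "continuous_on UNIV w" "\<And>x. \<bar>w x\<bar> \<le> 2" and D: "cubic_coeff a b w \<ge> 1 / 8"
  shows "\<bar>reaction \<alpha> \<kappa> a b w x\<bar> \<le> 130 * \<alpha> * K"
proof -
  note \<kappa>8 = abs_divide_le_8[OF \<kappa> D]
  have "\<bar>\<alpha> * w x\<bar> \<le> \<alpha> * 2" by (intro abs_mult_le w) (use \<kappa> in auto)
  moreover have "\<bar>\<kappa> / cubic_coeff a b w * cubic_term a b w x\<bar> \<le> \<alpha> * 8 * (16 * K)"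
    by (intro abs_mult_le \<kappa>8 cubic_term_bound ab w)
  moreover have "\<alpha> * 1 \<le> \<alpha> * K" using \<kappa> K by (intro mult_left_mono) auto
  moreover have "130 * \<alpha> * K = 2 * (\<alpha> * K) + \<alpha> * 8 * (16 * K)" by simp
  ultimately show ?thesis unfolding reaction_def by linarith
qed

lemma reaction_lipschitz:
  assumes ab: "\<bar>a\<bar> \<le> K" "\<bar>b\<bar> \<le> K" and \<kappa>: "0 \<le> \<kappa>" "\<kappa> \<le> \<alpha>" and K: "1 \<le> K"
    and c: "continuous_on UNIV w" "continuous_on UNIV w'"
    and w: "\<And>x. \<bar>w x\<bar> \<le> 2" "\<And>x. \<bar>w' x\<bar> \<le> 2"
    and D: "cubic_coeff a b w \<ge> 1 / 8" "cubic_coeff a b w' \<ge> 1 / 8"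
    and d: "\<And>x. \<bar>w x - w' x\<bar> \<le> d"
  shows "\<bar>reaction \<alpha> \<kappa> a b w x - reaction \<alpha> \<kappa> a b w' x\<bar> \<le> 30000 * \<alpha> * K ^ 2 * d"
proof -
  let ?D = "cubic_coeff a b w" and ?D' = "cubic_coeff a b w'"
  have d0: "0 \<le> d" using d[of 0] by linarith
  note \<kappa>8 = abs_divide_le_8[OF \<kappa> D(2)]
  \<comment> \<open>The amplitude is Lipschitz in the profile because the denominators stay above \<open>1 / 8\<close>.\<close>
  note \<kappa>d = abs_divide_diff_le[OF \<kappa> D cubic_coeff_lipschitz[OF ab c w d]]
  have 1: "\<bar>\<kappa> / ?D * cubic_term a b w x - \<kappa> / ?D' * cubic_term a b w' x\<bar>
      \<le> \<alpha> * 8 * (28 * K * d * 8) * (16 * K) + \<alpha> * 8 * (24 * K * d)"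
    by (intro abs_mult_diff_le \<kappa>d \<kappa>8 cubic_term_bound cubic_term_lipschitz ab c w d)
  have 2: "\<bar>\<alpha> * w x - \<alpha> * w' x\<bar> \<le> \<alpha> * d"
    using \<kappa> d[of x] by (simp add: right_diff_distrib[symmetric] abs_mult mult_left_mono)
  have \<alpha>d: "0 \<le> \<alpha> * d" using \<kappa> d0 by simp
  have "K \<le> K ^ 2" "1 \<le> K ^ 2" using K by (simp_all add: self_le_power)
  then have "\<alpha> * d * 1 \<le> \<alpha> * d * K ^ 2" "\<alpha> * d * K \<le> \<alpha> * d * K ^ 2"
    using \<alpha>d by (auto intro: mult_left_mono simp only:)
  moreover have "\<alpha> * 8 * (28 * K * d * 8) * (16 * K) + \<alpha> * 8 * (24 * K * d)
      = 28672 * (\<alpha> * d * K ^ 2) + 192 * (\<alpha> * d * K)"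
    by (simp add: power2_eq_square)
  moreover have "30000 * \<alpha> * K ^ 2 * d = 30000 * (\<alpha> * d * K ^ 2)" by simp
  moreover have "0 \<le> \<alpha> * d * K ^ 2" using \<alpha>d by simp
  ultimately show ?thesis using 1 2 unfolding reaction_def by linarith
qed

lemma cubic_term_even_periodic:
  "w \<in> even_periodic \<Longrightarrow> cubic_term a b w \<in> even_periodic"
  unfolding cubic_term_def [abs_def] by (intro even_periodic_intros)

lemma reaction_even_periodic:
  "w \<in> even_periodic \<Longrightarrow> reaction \<alpha> \<kappa> a b w \<in> even_periodic"
  unfolding reaction_def [abs_def] by (intro even_periodic_intros cubic_term_even_periodic)

lemma cos_mode_reaction:
  assumes w: "continuous_on UNIV w" "cos_mode w = 1" and D: "cubic_coeff a b w \<noteq> 0"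
  shows "cos_mode (reaction \<alpha> \<kappa> a b w) = \<alpha> - \<kappa>"
proof -
  have "cos_mode (cubic_term a b w) = - cubic_coeff a b w"
    unfolding cubic_term_def [abs_def] cubic_coeff_def
    using w by (simp add: cos_mode_diff cos_mode_scale continuous_intros)
  moreover have "continuous_on UNIV (cubic_term a b w)"
    unfolding cubic_term_def [abs_def] by (intro continuous_intros w)
  ultimately have "cos_mode (\<lambda>x. \<kappa> / cubic_coeff a b w * cubic_term a b w x) = - \<kappa>"
      "continuous_on UNIV (\<lambda>x. \<kappa> / cubic_coeff a b w * cubic_term a b w x)"
    using D cos_mode_scale[of "cubic_term a b w" "\<kappa> / cubic_coeff a b w"]
    by (auto intro!: continuous_intros)
  then show ?thesis
    unfolding reaction_def [abs_def]
    using w by (subst cos_mode_add) (auto simp: cos_mode_scale intro!: continuous_intros)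
qed

text \<open>For the coefficients \<open>1 - 2 s\<close> and \<open>1 - 3 s\<close> the value is \<open>1 / 4\<close> for every \<open>s\<close>. Hence the squared
amplitude is \<open>4 \<kappa>\<close> to leading order.\<close>

lemma cubic_coeff_cos: "cubic_coeff a b cos = 3 * a / 4 - b / 2"
  by (simp add: cubic_coeff_def cos_mode_cos_cube avg_cos_sq)

section \<open>The profile equation\<close>

text \<open>Parametrising the profile by \<open>\<psi> = (1 + \<partial>\<^sup>2)\<^sup>2 w\<close> makes it four times differentiable for every
continuous \<open>\<psi>\<close>, so the fixed point argument can be carried out in the supremum norm.\<close>

definition profile_of :: "(real \<Rightarrow> real) \<Rightarrow> real \<Rightarrow> real" where
  "profile_of \<psi> x = cos x + inv_helmholtz (inv_helmholtz \<psi>) x"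

text \<open>With \<open>S\<close> the inverse of \<open>1 + \<partial>\<^sup>2\<close> and \<open>k\<^sup>2 = 1 + \<delta>\<close> one has
\<open>(1 + k\<^sup>2 \<partial>\<^sup>2) S = (1 + \<delta>) - \<delta> S\<close>. The profile equation
\<open>(1 + k\<^sup>2 \<partial>\<^sup>2)\<^sup>2 w = \<epsilon>\<^sup>2 F w\<close> therefore reads
\<open>((1 + \<delta>) - \<delta> S)\<^sup>2 \<psi> + \<epsilon>\<^sup>2 q\<^sup>2 cos = \<epsilon>\<^sup>2 F w\<close>, where \<open>\<delta> = \<epsilon> q\<close> and the extra
term is the image of \<open>cos\<close>. Expanding the square and solving for the isolated \<open>\<psi>\<close> gives this
map. Treating the detuning as a perturbation keeps the near-resonant operator \<open>1 + k\<^sup>2 \<partial>\<^sup>2\<close> from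
ever being inverted.\<close>

definition profile_map ::
    "real \<Rightarrow> real \<Rightarrow> real \<Rightarrow> real \<Rightarrow> real \<Rightarrow> real \<Rightarrow> (real \<Rightarrow> real) \<Rightarrow> real \<Rightarrow> real" where
  "profile_map \<alpha> a b q \<epsilon> \<delta> \<psi> x =
     \<epsilon>\<^sup>2 * (reaction \<alpha> (\<alpha> - q\<^sup>2) a b (profile_of \<psi>) x - q\<^sup>2 * cos x)
     - ((2 * \<delta> + \<delta>\<^sup>2) * \<psi> x - 2 * \<delta> * (1 + \<delta>) * inv_helmholtz \<psi> x
        + \<delta>\<^sup>2 * inv_helmholtz (inv_helmholtz \<psi>) x)"

text \<open>The three coefficients are at most \<open>3 h\<close>, \<open>4 h\<close> and \<open>h\<close>; with the factors \<open>48\<close> and \<open>48\<^sup>2\<close> from one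
and two applications of the inverse operator they add up to \<open>3 + 192 + 2304 \<le> 2500\<close>.\<close>

lemma detuning_part_le:
  fixes \<delta> :: real
  assumes "\<bar>\<delta>\<bar> \<le> h" "h \<le> 1" "\<bar>x\<bar> \<le> d" "\<bar>y\<bar> \<le> 48 * d" "\<bar>z\<bar> \<le> 48 * (48 * d)"
  shows "\<bar>(2 * \<delta> + \<delta>\<^sup>2) * x - 2 * \<delta> * (1 + \<delta>) * y + \<delta>\<^sup>2 * z\<bar> \<le> 2500 * h * d"
proof -
  have h0: "0 \<le> h" using assms by linarith
  have \<delta>2: "\<bar>\<delta>\<^sup>2\<bar> \<le> h"
    using abs_mult_le[OF assms(1), of \<delta> 1] assms by (simp add: power2_eq_square)
  have "\<bar>2 * \<delta> * (1 + \<delta>)\<bar> \<le> 4 * h"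
  proof -
    have "2 * \<delta> * (1 + \<delta>) = 2 * \<delta> + 2 * \<delta>\<^sup>2" by (simp add: power2_eq_square algebra_simps)
    then show ?thesis using \<delta>2 assms(1) by linarith
  qed
  from abs_mult_le[OF this assms(4)]
  have 1: "\<bar>2 * \<delta> * (1 + \<delta>) * y\<bar> \<le> 192 * (h * d)" by simp
  have "\<bar>2 * \<delta> + \<delta>\<^sup>2\<bar> \<le> 3 * h" using \<delta>2 assms(1) by linarith
  from abs_mult_le[OF this assms(3)]
  have 2: "\<bar>(2 * \<delta> + \<delta>\<^sup>2) * x\<bar> \<le> 3 * (h * d)" by simp
  from abs_mult_le[OF \<delta>2 assms(5)]
  have 3: "\<bar>\<delta>\<^sup>2 * z\<bar> \<le> 2304 * (h * d)" by simp
  have "0 \<le> h * d" using h0 assms(3) by simp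
  with 1 2 3 show ?thesis by linarith
qed

lemma perp_ballD:
  assumes "\<psi> \<in> perp_ball r"
  shows "\<psi> \<in> even_periodic" "cos_mode \<psi> = 0" "\<bar>\<psi> x\<bar> \<le> r"
  using assms by (auto simp: perp_ball_def)

lemma inv_helmholtz_perp_ball:
  assumes "\<psi> \<in> perp_ball r"
  shows "inv_helmholtz \<psi> \<in> perp_ball (48 * r)"
  using perp_ballD[OF assms] unfolding perp_ball_def
  by (auto intro!: inv_helmholtz_even_periodic cos_mode_inv_helmholtz inv_helmholtz_bound
      dest: even_periodicD(1)[where A = UNIV])

lemma profile_of_even_periodic:
  assumes "\<psi> \<in> perp_ball r"
  shows "profile_of \<psi> \<in> even_periodic" "cos_mode (profile_of \<psi>) = 1"
    "\<bar>profile_of \<psi> x - cos x\<bar> \<le> 48 * (48 * r)"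
proof -
  note 2 = inv_helmholtz_perp_ball[OF inv_helmholtz_perp_ball[OF assms]]
  show "profile_of \<psi> \<in> even_periodic"
    unfolding profile_of_def [abs_def] by (intro even_periodic_intros perp_ballD(1)[OF 2])
  show "cos_mode (profile_of \<psi>) = 1"
    unfolding profile_of_def [abs_def]
    using perp_ballD(2)[OF 2] even_periodicD(1)[OF perp_ballD(1)[OF 2]]
    by (subst cos_mode_add) (auto intro: continuous_intros simp: cos_mode_cos)
  show "\<bar>profile_of \<psi> x - cos x\<bar> \<le> 48 * (48 * r)"
    using perp_ballD(3)[OF 2] by (simp add: profile_of_def)
qed

lemma profile_of_near_cos:
  assumes "\<psi> \<in> perp_ball \<epsilon>" and ab: "\<bar>a\<bar> \<le> K" "\<bar>b\<bar> \<le> K" "3 * a / 4 - b / 2 = 1 / 4"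
    and K: "1 \<le> K" and \<epsilon>: "520000 * K * \<epsilon> \<le> 1"
  shows "\<bar>profile_of \<psi> x\<bar> \<le> 2"
    and "\<bar>cubic_coeff a b (profile_of \<psi>) - 1 / 4\<bar> \<le> 65000 * K * \<epsilon>"
    and "cubic_coeff a b (profile_of \<psi>) \<ge> 1 / 8"
proof -
  note w = profile_of_even_periodic[OF assms(1)]
  have \<epsilon>0: "0 \<le> \<epsilon>" using perp_ballD(3)[OF assms(1), of 0] by linarith
  have "1 * \<epsilon> \<le> K * \<epsilon>" using K \<epsilon>0 by (intro mult_right_mono)
  then have \<epsilon>1: "48 * (48 * \<epsilon>) \<le> 1" using \<epsilon> by simp
  show le2: "\<bar>profile_of \<psi> x\<bar> \<le> 2" for x
    using w(3)[of x] \<epsilon>1 abs_cos_le_one[of x] by linarith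
  have le2': "\<bar>cos x\<bar> \<le> 2" for x :: real using abs_cos_le_one[of x] by linarith
  have "\<bar>cubic_coeff a b (profile_of \<psi>) - cubic_coeff a b cos\<bar> \<le> 28 * K * (48 * (48 * \<epsilon>))"
    by (intro cubic_coeff_lipschitz ab w even_periodicD(1)[OF w(1)] le2 le2' continuous_intros)
  moreover have "0 \<le> K * \<epsilon>" using K \<epsilon>0 by simp
  ultimately show D: "\<bar>cubic_coeff a b (profile_of \<psi>) - 1 / 4\<bar> \<le> 65000 * K * \<epsilon>"
    using ab(3) unfolding cubic_coeff_cos by simp
  then show "cubic_coeff a b (profile_of \<psi>) \<ge> 1 / 8"
    using \<epsilon> by linarith
qed

text \<open>The profile equation is solved for \<open>\<epsilon>\<close> up to half the reciprocal of this number, where \<open>K\<close> bounds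
\<open>\<bar>a\<bar>\<close> and \<open>\<bar>b\<bar>\<close>. The three summands control the detuning terms, the Lipschitz constant
\<open>30000 \<alpha> K\<^sup>2 * 48\<^sup>2\<close> of the reaction term as a function of \<open>\<psi>\<close>, and the deviation of
\<open>cubic_coeff\<close> from \<open>1 / 4\<close>.\<close>

definition smallness :: "real \<Rightarrow> real \<Rightarrow> real" where
  "smallness \<alpha> K = 2500 * sqrt \<alpha> + 70000000 * \<alpha> * K\<^sup>2 + 520000 * K"

lemma smallness_pos:
  assumes "\<alpha> > 0" "K \<ge> 1"
  shows "smallness \<alpha> K > 0"
  unfolding smallness_def
  by (intro add_nonneg_pos add_nonneg_nonneg mult_nonneg_nonneg) (use assms in auto)

lemma
  assumes "\<alpha> > 0" "K \<ge> 1" "\<epsilon> > 0" "\<epsilon> * smallness \<alpha> K \<le> 1 / 2"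
  shows eps_sqrt_small: "\<epsilon> * sqrt \<alpha> \<le> 1 / 2"
    and eps_K_small: "520000 * K * \<epsilon> \<le> 1"
    and eps_le_1: "\<epsilon> \<le> 1"
    and eps_small: "\<epsilon> * (2500 * sqrt \<alpha> + 70000000 * \<alpha> * K\<^sup>2) \<le> 1 / 2"
proof -
  have p: "0 < \<epsilon> * sqrt \<alpha>" "0 < \<epsilon> * \<alpha> * K\<^sup>2" "\<epsilon> \<le> \<epsilon> * K"
    using assms by (auto intro!: mult_pos_pos)
  have eq: "\<epsilon> * smallness \<alpha> K =
      2500 * (\<epsilon> * sqrt \<alpha>) + 70000000 * (\<epsilon> * \<alpha> * K\<^sup>2) + 520000 * (\<epsilon> * K)"
    by (simp add: smallness_def algebra_simps)
  have eq': "\<epsilon> * (2500 * sqrt \<alpha> + 70000000 * \<alpha> * K\<^sup>2) =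
      2500 * (\<epsilon> * sqrt \<alpha>) + 70000000 * (\<epsilon> * \<alpha> * K\<^sup>2)"
    by (simp add: algebra_simps)
  show "\<epsilon> * sqrt \<alpha> \<le> 1 / 2" using p eq assms by linarith
  show "520000 * K * \<epsilon> \<le> 1" using p eq assms mult.assoc[of 520000 K \<epsilon>] mult.commute[of K \<epsilon>] by linarith
  show "\<epsilon> \<le> 1" using p eq assms by linarith
  show "\<epsilon> * (2500 * sqrt \<alpha> + 70000000 * \<alpha> * K\<^sup>2) \<le> 1 / 2" using p eq eq' assms by linarith
qed

text \<open>On the ball of radius \<open>\<epsilon>\<close> the map contracts with factor \<open>1 / 2\<close>, since each of its terms carries a
factor \<open>\<epsilon>\<close>. It keeps the first mode equal to zero because the reaction term has first mode \<open>q\<^sup>2\<close>.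
No constant depends on \<open>\<epsilon>\<close> or \<open>q\<close>.\<close>

lemma profile_map_fixpoint:
  assumes \<alpha>: "\<alpha> > 0" and K: "K \<ge> 1"
    and ab: "\<bar>a\<bar> \<le> K" "\<bar>b\<bar> \<le> K" "3 * a / 4 - b / 2 = 1 / 4"
    and \<epsilon>: "\<epsilon> > 0" "\<epsilon> * smallness \<alpha> K \<le> 1 / 2" and q: "\<bar>q\<bar> < sqrt \<alpha>"
  shows "\<exists>\<psi>\<in>perp_ball \<epsilon>. profile_map \<alpha> a b q \<epsilon> (\<epsilon> * q) \<psi> = \<psi>"
proof -
  define h where "h = \<epsilon> * sqrt \<alpha>"
  define \<delta> where "\<delta> = \<epsilon> * q"
  note small = eps_sqrt_small[OF \<alpha> K \<epsilon>] eps_K_small[OF \<alpha> K \<epsilon>] eps_le_1[OF \<alpha> K \<epsilon>] eps_small[OF \<alpha> K \<epsilon>]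
  have h: "h \<le> 1" using small(1) by (simp add: h_def)
  have \<delta>: "\<bar>\<delta>\<bar> \<le> h" using q \<epsilon> by (simp add: \<delta>_def h_def abs_mult mult_left_mono)
  have q2: "0 \<le> q\<^sup>2" "q\<^sup>2 \<le> \<alpha>"
    using q \<alpha> abs_le_square_iff[of q "sqrt \<alpha>"] by auto
  then have \<kappa>: "0 \<le> \<alpha> - q\<^sup>2" "\<alpha> - q\<^sup>2 \<le> \<alpha>" by auto
  note near = profile_of_near_cos[OF _ ab K small(2)]
  let ?F = "\<lambda>\<psi>. reaction \<alpha> (\<alpha> - q\<^sup>2) a b (profile_of \<psi>)"
  have "\<exists>f\<in>perp_ball \<epsilon>. profile_map \<alpha> a b q \<epsilon> \<delta> f = f"
  proof (rule uniform_contraction_fixpoint[where c = "1 / 2" and r = \<epsilon>])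
    have "cos_mode (\<lambda>x. 0) = 0" using cos_mode_scale[of "\<lambda>x. 0" 0] by simp
    then have "(\<lambda>x. 0) \<in> perp_ball \<epsilon>"
      using \<epsilon> by (auto simp: perp_ball_def intro: even_periodic_intros)
    then show "perp_ball \<epsilon> \<noteq> {}" by blast
  next
    fix f assume "f \<in> perp_ball \<epsilon>"
    then show "continuous_on UNIV f" "\<bar>f x\<bar> \<le> \<epsilon>" for x
      using perp_ballD even_periodicD(1) by blast+
  next
    fix f :: "real \<Rightarrow> real"
    assume "continuous_on UNIV f" "\<And>d. d > 0 \<Longrightarrow> \<exists>g\<in>perp_ball \<epsilon>. \<forall>x. \<bar>g x - f x\<bar> \<le> d"
    then show "f \<in> perp_ball \<epsilon>" by (rule perp_ball_closed)
  next
    fix \<psi> assume \<psi>: "\<psi> \<in> perp_ball \<epsilon>"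
    note S1 = inv_helmholtz_perp_ball[OF \<psi>]
    note S2 = inv_helmholtz_perp_ball[OF S1]
    note w = profile_of_even_periodic[OF \<psi>]
    have D: "cubic_coeff a b (profile_of \<psi>) \<noteq> 0" using near(3)[OF \<psi>] by auto
    note F = reaction_even_periodic[OF w(1), of \<alpha> "\<alpha> - q\<^sup>2" a b]
    note ep = F perp_ballD(1)[OF \<psi>] perp_ballD(1)[OF S1] perp_ballD(1)[OF S2]
    note co = ep[THEN even_periodicD(1)]
    have "profile_map \<alpha> a b q \<epsilon> \<delta> \<psi> \<in> even_periodic"
      unfolding profile_map_def [abs_def] by (intro even_periodic_intros ep)
    moreover have "cos_mode (profile_map \<alpha> a b q \<epsilon> \<delta> \<psi>) = 0"
      unfolding profile_map_def [abs_def]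
      using perp_ballD(2)[OF \<psi>] perp_ballD(2)[OF S1] perp_ballD(2)[OF S2]
        cos_mode_reaction[OF even_periodicD(1)[OF w(1)] w(2) D]
      by (simp add: cos_mode_add cos_mode_diff cos_mode_scale cos_mode_cos co continuous_intros)
    moreover have "\<bar>profile_map \<alpha> a b q \<epsilon> \<delta> \<psi> x\<bar> \<le> \<epsilon>" for x
    proof -
      have 1: "\<bar>(2 * \<delta> + \<delta>\<^sup>2) * \<psi> x - 2 * \<delta> * (1 + \<delta>) * inv_helmholtz \<psi> x
          + \<delta>\<^sup>2 * inv_helmholtz (inv_helmholtz \<psi>) x\<bar> \<le> 2500 * h * \<epsilon>"
        by (rule detuning_part_le[OF \<delta> h perp_ballD(3)[OF \<psi>] perp_ballD(3)[OF S1] perp_ballD(3)[OF S2]])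
      have F1: "\<bar>?F \<psi> x\<bar> \<le> 130 * \<alpha> * K"
        by (rule reaction_bound[OF ab(1,2) \<kappa> K even_periodicD(1)[OF w(1)] near(1,3)[OF \<psi>]])
      have F2: "\<bar>q\<^sup>2 * cos x\<bar> \<le> \<alpha> * 1" by (rule abs_mult_le) (use q2 in auto)
      have "K \<le> K\<^sup>2" "1 \<le> K\<^sup>2" using K by (simp_all add: self_le_power)
      then have "\<alpha> * K \<le> \<alpha> * K\<^sup>2" "\<alpha> * 1 \<le> \<alpha> * K\<^sup>2" using \<alpha> by (auto intro!: mult_left_mono)
      with F1 F2 have "\<bar>?F \<psi> x - q\<^sup>2 * cos x\<bar> \<le> 70000000 * \<alpha> * K\<^sup>2" by linarith
      then have "\<bar>\<epsilon>\<^sup>2 * (?F \<psi> x - q\<^sup>2 * cos x)\<bar> \<le> \<epsilon>\<^sup>2 * (70000000 * \<alpha> * K\<^sup>2)"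
        by (intro abs_mult_le) auto
      with 1 have "\<bar>profile_map \<alpha> a b q \<epsilon> \<delta> \<psi> x\<bar>
          \<le> \<epsilon>\<^sup>2 * (70000000 * \<alpha> * K\<^sup>2) + 2500 * h * \<epsilon>"
        unfolding profile_map_def by linarith
      also have "\<dots> = \<epsilon> * (\<epsilon> * (2500 * sqrt \<alpha> + 70000000 * \<alpha> * K\<^sup>2))"
        by (simp add: h_def power2_eq_square algebra_simps)
      also have "\<dots> \<le> \<epsilon> * 1" using small(4) \<epsilon>(1) by (intro mult_left_mono) auto
      finally show ?thesis by simp
    qed
    ultimately show "profile_map \<alpha> a b q \<epsilon> \<delta> \<psi> \<in> perp_ball \<epsilon>"
      by (simp add: perp_ball_def)
  next
    fix f g :: "real \<Rightarrow> real" and d x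
    assume f: "f \<in> perp_ball \<epsilon>" and g: "g \<in> perp_ball \<epsilon>" and d: "\<And>x. \<bar>f x - g x\<bar> \<le> d"
    note f1 = inv_helmholtz_perp_ball[OF f] and g1 = inv_helmholtz_perp_ball[OF g]
    have d1: "\<bar>inv_helmholtz f x - inv_helmholtz g x\<bar> \<le> 48 * d" for x
      by (intro inv_helmholtz_lipschitz perp_ballD[OF f] perp_ballD[OF g] d)
    have d2: "\<bar>inv_helmholtz (inv_helmholtz f) x - inv_helmholtz (inv_helmholtz g) x\<bar> \<le> 48 * (48 * d)" for x
      by (intro inv_helmholtz_lipschitz perp_ballD[OF f1] perp_ballD[OF g1] d1)
    have d0: "0 \<le> d" using d[of 0] by linarith
    note 1 = detuning_part_le[OF \<delta> h d d1 d2, of x x x]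
    have dw: "\<bar>profile_of f x - profile_of g x\<bar> \<le> 48 * (48 * d)" for x
      using d2 by (simp add: profile_of_def)
    note cw = even_periodicD(1)[OF profile_of_even_periodic(1)]
    have "\<bar>?F f x - ?F g x\<bar> \<le> 30000 * \<alpha> * K\<^sup>2 * (48 * (48 * d))"
      by (rule reaction_lipschitz[OF ab(1,2) \<kappa> K cw[OF f] cw[OF g] near(1)[OF f] near(1)[OF g]
          near(3)[OF f] near(3)[OF g] dw])
    moreover have "0 \<le> \<alpha> * K\<^sup>2 * d" using \<alpha> d0 by simp
    ultimately have "\<bar>?F f x - ?F g x\<bar> \<le> 70000000 * \<alpha> * K\<^sup>2 * d" by simp
    moreover have "\<bar>\<epsilon>\<^sup>2\<bar> \<le> \<epsilon>" using \<epsilon> small(3) by (simp add: power2_eq_square mult_left_le)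
    ultimately have 2: "\<bar>\<epsilon>\<^sup>2 * (?F f x - ?F g x)\<bar> \<le> \<epsilon> * (70000000 * \<alpha> * K\<^sup>2 * d)"
      by (intro abs_mult_le)
    have "profile_map \<alpha> a b q \<epsilon> \<delta> f x - profile_map \<alpha> a b q \<epsilon> \<delta> g x
      = \<epsilon>\<^sup>2 * (?F f x - ?F g x) - ((2 * \<delta> + \<delta>\<^sup>2) * (f x - g x)
        - 2 * \<delta> * (1 + \<delta>) * (inv_helmholtz f x - inv_helmholtz g x)
        + \<delta>\<^sup>2 * (inv_helmholtz (inv_helmholtz f) x - inv_helmholtz (inv_helmholtz g) x))"
      unfolding profile_map_def by algebra
    with 1 2 have "\<bar>profile_map \<alpha> a b q \<epsilon> \<delta> f x - profile_map \<alpha> a b q \<epsilon> \<delta> g x\<bar>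
      \<le> \<epsilon> * (70000000 * \<alpha> * K\<^sup>2 * d) + 2500 * h * d" by linarith
    also have "\<dots> = \<epsilon> * (2500 * sqrt \<alpha> + 70000000 * \<alpha> * K\<^sup>2) * d"
      by (simp add: h_def algebra_simps)
    also have "\<dots> \<le> 1 / 2 * d" using small(4) d0 by (intro mult_right_mono)
    finally show "\<bar>profile_map \<alpha> a b q \<epsilon> \<delta> f x - profile_map \<alpha> a b q \<epsilon> \<delta> g x\<bar> \<le> 1 / 2 * d" .
  qed auto
  then show ?thesis by (simp add: \<delta>_def)
qed

text \<open>The fixed point as a classical solution, given with its successive derivatives \<open>W 1\<close> to \<open>W 4\<close>. They
are explicit, because differentiating \<open>S f\<close> twice gives \<open>f - S f\<close>.\<close>

lemma profile_exists:
  assumes \<alpha>: "\<alpha> > 0" and K: "K \<ge> 1"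
    and ab: "\<bar>a\<bar> \<le> K" "\<bar>b\<bar> \<le> K" "3 * a / 4 - b / 2 = 1 / 4"
    and \<epsilon>: "\<epsilon> > 0" "\<epsilon> * smallness \<alpha> K \<le> 1 / 2" and q: "\<bar>q\<bar> < sqrt \<alpha>"
  obtains W :: "nat \<Rightarrow> real \<Rightarrow> real" where
    "W 0 \<in> even_periodic" "\<And>j x. j < 4 \<Longrightarrow> (W j has_real_derivative W (Suc j) x) (at x)"
    "continuous_on UNIV (W 4)"
    "\<And>x. W 0 x + 2 * (1 + \<epsilon> * q) * W 2 x + (1 + \<epsilon> * q)\<^sup>2 * W 4 x
       = \<epsilon>\<^sup>2 * reaction \<alpha> (\<alpha> - q\<^sup>2) a b (W 0) x"
    "\<And>x. \<bar>W 0 x - cos x\<bar> \<le> 2304 * \<epsilon>" "\<And>x. \<bar>W 0 x\<bar> \<le> 2"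
    "\<bar>cubic_coeff a b (W 0) - 1 / 4\<bar> \<le> 65000 * K * \<epsilon>" "cubic_coeff a b (W 0) \<ge> 1 / 8"
proof -
  obtain \<psi> where \<psi>: "\<psi> \<in> perp_ball \<epsilon>" and fp: "profile_map \<alpha> a b q \<epsilon> (\<epsilon> * q) \<psi> = \<psi>"
    using profile_map_fixpoint[OF assms] by blast
  define \<delta> where "\<delta> = \<epsilon> * q"
  define \<eta> where "\<eta> = inv_helmholtz \<psi>"
  define \<phi> where "\<phi> = inv_helmholtz \<eta>"
  have c: "continuous_on UNIV \<psi>" "continuous_on UNIV \<eta>" "continuous_on UNIV \<phi>"
    unfolding \<eta>_def \<phi>_def
    using \<psi> inv_helmholtz_perp_ball perp_ballD(1) even_periodicD(1) by blast+
  define W :: "nat \<Rightarrow> real \<Rightarrow> real" where "W j = [profile_of \<psi>,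
      \<lambda>x. - sin x + inv_helmholtz_deriv \<eta> x,
      \<lambda>x. - cos x + (\<eta> x - \<phi> x),
      \<lambda>x. sin x + (inv_helmholtz_deriv \<psi> x - inv_helmholtz_deriv \<eta> x),
      \<lambda>x. cos x + (\<psi> x - \<eta> x - (\<eta> x - \<phi> x))] ! j" for j
  have W: "W 0 = profile_of \<psi>" "W 2 = (\<lambda>x. - cos x + (\<eta> x - \<phi> x))"
      "W 4 = (\<lambda>x. cos x + (\<psi> x - \<eta> x - (\<eta> x - \<phi> x)))"
      "W 1 = (\<lambda>x. - sin x + inv_helmholtz_deriv \<eta> x)"
      "W 3 = (\<lambda>x. sin x + (inv_helmholtz_deriv \<psi> x - inv_helmholtz_deriv \<eta> x))"
    by (simp_all add: W_def)
  have p: "profile_of \<psi> = (\<lambda>x. cos x + \<phi> x)" by (auto simp: profile_of_def \<phi>_def \<eta>_def)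
  note d = inv_helmholtz_has_deriv[OF c(1), folded \<eta>_def] inv_helmholtz_has_deriv[OF c(2), folded \<phi>_def]
    inv_helmholtz_deriv_has_deriv[OF c(1), folded \<eta>_def] inv_helmholtz_deriv_has_deriv[OF c(2), folded \<phi>_def]
  show thesis
  proof (rule that[of W])
    show "(W j has_real_derivative W (Suc j) x) (at x)" if "j < 4" for j x
    proof -
      have "j = 0 \<or> j = 1 \<or> j = 2 \<or> j = 3" using that by auto
      then show ?thesis
        using W p by (auto simp: eval_nat_numeral intro!: derivative_eq_intros d)
    qed
    show "W 0 x + 2 * (1 + \<epsilon> * q) * W 2 x + (1 + \<epsilon> * q)\<^sup>2 * W 4 x
        = \<epsilon>\<^sup>2 * reaction \<alpha> (\<alpha> - q\<^sup>2) a b (W 0) x" for x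
    proof -
      have "\<psi> x = \<epsilon>\<^sup>2 * (reaction \<alpha> (\<alpha> - q\<^sup>2) a b (W 0) x - q\<^sup>2 * cos x)
          - ((2 * \<delta> + \<delta>\<^sup>2) * \<psi> x - 2 * \<delta> * (1 + \<delta>) * \<eta> x + \<delta>\<^sup>2 * \<phi> x)"
        using fun_cong[OF fp, of x] unfolding profile_map_def W \<eta>_def \<phi>_def \<delta>_def by simp
      then show ?thesis
        unfolding W(2,3) \<delta>_def [symmetric] unfolding W(1) p \<delta>_def by algebra
    qed
    show "\<bar>W 0 x - cos x\<bar> \<le> 2304 * \<epsilon>" for x
      using profile_of_even_periodic(3)[OF \<psi>, of x] by (simp add: W)
  qed (use profile_of_near_cos[OF \<psi> ab K eps_K_small[OF \<alpha> K \<epsilon>]] profile_of_even_periodic[OF \<psi>] c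
      in \<open>auto simp: W intro!: continuous_intros\<close>)
qed

section \<open>From profiles to stationary solutions\<close>

text \<open>Smoothness is handled by listing the derivatives \<open>W 1, W 2, \<dots>\<close> of \<open>W 0\<close>; the iterated \<open>deriv\<close> is then
evaluated by looking them up.\<close>

lemma funpow_deriv_chain:
  assumes "\<And>j x. j < n \<Longrightarrow> (W j has_real_derivative W (Suc j) x) (at x)" "j \<le> n"
  shows "(deriv ^^ j) (W 0) = W j"
  using assms(2)
proof (induction j)
  case (Suc j)
  then show ?case using assms(1)[of j] by (auto intro!: ext DERIV_imp_deriv)
qed simp

lemma C_diff_chain:
  assumes "\<And>j x. j < n \<Longrightarrow> (W j has_real_derivative W (Suc j) x) (at x)" "continuous_on UNIV (W n)"
  shows "C_diff n (W 0)"
  using assms funpow_deriv_chain[of n W] field_differentiable_def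
  unfolding C_diff_def by (metis less_imp_le order_refl)

text \<open>The second equation says that \<open>v + \<gamma> u\<^sup>2\<close> has vanishing second derivative. It is solved by making
that function constant, which leaves a scalar equation for \<open>u\<close>. The constant \<open>m\<close> is free here and
later fixes the mean of \<open>v\<close>.\<close>

lemma stationary_solutionI:
  fixes u :: "nat \<Rightarrow> real \<Rightarrow> real"
  assumes d: "\<And>j x. j < 4 \<Longrightarrow> (u j has_real_derivative u (Suc j) x) (at x)"
    and c: "continuous_on UNIV (u 4)"
    and eq: "\<And>x. u 0 x + 2 * u 2 x + u 4 x = \<alpha> * u 0 x - \<gamma> * u 0 x * ((u 0 x)\<^sup>2 - m) - u 0 x ^ 3"
  shows "stationary_solution \<alpha> \<gamma> (u 0) (\<lambda>x. - \<gamma> * ((u 0 x)\<^sup>2 - m))"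
proof -
  have d': "(u 0 has_real_derivative u 1 x) (at x)" "(u 1 has_real_derivative u 2 x) (at x)"
    "(u 2 has_real_derivative u 3 x) (at x)" "(u 3 has_real_derivative u 4 x) (at x)" for x
    using d[of 0] d[of 1] d[of 2] d[of 3] by (simp_all add: eval_nat_numeral)
  have cu: "continuous_on UNIV (u j)" if "j < 4" for j
    using d[OF that] by (meson DERIV_isCont continuous_at_imp_continuous_on)
  define Q where "Q j = [\<lambda>x. (u 0 x)\<^sup>2, \<lambda>x. 2 * u 0 x * u 1 x,
      \<lambda>x. 2 * (u 1 x)\<^sup>2 + 2 * u 0 x * u 2 x] ! j" for j
  define V where "V j = (\<lambda>x. - \<gamma> * (Q j x - (if j = 0 then m else 0)))" for j
  have Q: "Q 0 = (\<lambda>x. (u 0 x)\<^sup>2)" "Q 1 = (\<lambda>x. 2 * u 0 x * u 1 x)"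
      "Q 2 = (\<lambda>x. 2 * (u 1 x)\<^sup>2 + 2 * u 0 x * u 2 x)"
    by (simp_all add: Q_def)
  have Qs: "(Q 0 has_real_derivative Q 1 x) (at x)" "(Q 1 has_real_derivative Q 2 x) (at x)" for x
    unfolding Q power2_eq_square
    by (rule derivative_eq_intros d' refl | simp del: One_nat_def)+
  have Qd: "(Q j has_real_derivative Q (Suc j) x) (at x)" if "j < 2" for j x
  proof -
    have "(j = 0 \<and> Suc j = 1) \<or> (j = 1 \<and> Suc j = 2)" using that by auto
    then show ?thesis by (elim disjE conjE) (simp_all only: Qs)
  qed
  have Vd: "(V j has_real_derivative V (Suc j) x) (at x)" if "j < 2" for j x
    unfolding V_def
    by (rule DERIV_cong[OF DERIV_cmult[OF DERIV_diff[OF Qd[OF that] DERIV_const]]]) simp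
  have Q2c: "continuous_on UNIV (Q 2)"
    unfolding Q_def by (auto intro!: continuous_intros cu)
  have V2c: "continuous_on UNIV (V 2)"
    unfolding V_def by (intro continuous_intros Q2c)
  have V0: "V 0 = (\<lambda>x. - \<gamma> * ((u 0 x)\<^sup>2 - m))" by (simp add: V_def Q_def)
  define X where "X j = (\<lambda>x. u j x + u (j + 2) x)" for j
  have Xd: "(X j has_real_derivative X (Suc j) x) (at x)" if "j < 2" for j x
    unfolding X_def using that by (auto intro!: derivative_eq_intros d)
  have "(deriv ^^ 2) (u 0) = u 2"
    by (rule funpow_deriv_chain[of 4]) (use d in auto)
  then have 1: "one_plus_dxx (u 0) = X 0"
    by (simp only: one_plus_dxx_def X_def add_0)
  have 2: "one_plus_dxx (X 0) = (\<lambda>x. X 0 x + X 2 x)"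
    using funpow_deriv_chain[of 2 X 2] Xd by (auto simp: one_plus_dxx_def)
  have bi: "one_plus_dxx (one_plus_dxx (u 0)) x = u 0 x + 2 * u 2 x + u 4 x" for x
    unfolding 1 2 by (simp add: X_def del: add_2_eq_Suc')
  have SH: "- one_plus_dxx (one_plus_dxx (u 0)) x + \<alpha> * u 0 x + u 0 x * V 0 x - u 0 x ^ 3 = 0" for x
    unfolding bi eq V0 by (simp add: algebra_simps)
  have cons: "(deriv ^^ 2) (V 0) x + \<gamma> * (deriv ^^ 2) (\<lambda>y. (u 0 y)\<^sup>2) x = 0" for x
    using funpow_deriv_chain[of 2 V 2] Vd funpow_deriv_chain[of 2 Q 2] Qd
    unfolding Q(1) [symmetric] by (simp add: V_def)
  show ?thesis
    unfolding stationary_solution_def solves_SH_cons_def V0 [symmetric] SH cons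
    using C_diff_chain[of 4 u] C_diff_chain[of 2 V] d c Vd V2c by auto
qed

lemma has_integral_over_period:
  assumes f: "continuous_on UNIV f" and per: "\<And>x. f (x + 2 * pi) = f x" and k: "k > 0"
  shows "((\<lambda>x. f (k * (x + x0)) - avg f) has_integral 0) {0..2 * pi / k}"
proof -
  let ?P = "\<lambda>x. primitive f (k * (x + x0)) / k - avg f * x"
  have "((\<lambda>x. f (k * (x + x0)) - avg f) has_integral (?P (2 * pi / k) - ?P 0)) {0..2 * pi / k}"
  proof (rule fundamental_theorem_of_calculus)
    fix x
    have "(?P has_real_derivative f (k * (x + x0)) - avg f) (at x within {0..2 * pi / k})"
      using k by (auto intro!: derivative_eq_intros f)
    then show "(?P has_vector_derivative f (k * (x + x0)) - avg f) (at x within {0..2 * pi / k})"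
      by (simp add: has_real_derivative_iff_has_vector_derivative)
  qed (use k in simp)
  moreover have "k * (2 * pi / k + x0) = k * x0 + 2 * pi" using k by (simp add: field_simps)
  then have "?P (2 * pi / k) - ?P 0 =
      (primitive f (k * x0 + 2 * pi) - primitive f (k * x0)) / k - avg f * (2 * pi / k)"
    by (simp add: diff_divide_distrib)
  then have "?P (2 * pi / k) - ?P 0 = 0"
    using primitive_periodic[OF f per, of "k * x0"] by (simp add: avg_def)
  ultimately show ?thesis by simp
qed

text \<open>Writing the amplitude as \<open>sqrt \<kappa> * (1 / sqrt D)\<close> isolates the factor that vanishes when \<open>\<kappa>\<close> does,
so the error is of order \<open>\<epsilon>\<close> uniformly up to the ends of the interval of wave numbers.\<close>

lemma amplitude_error:
  assumes \<kappa>: "0 \<le> \<kappa>" "\<kappa> \<le> \<alpha>" and K: "1 \<le> K" and \<epsilon>: "0 < \<epsilon>"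
    and D: "D \<ge> 1 / 8" "\<bar>D - 1 / 4\<bar> \<le> 65000 * K * \<epsilon>"
    and w: "\<bar>w\<bar> \<le> 2" "\<bar>w - c\<bar> \<le> 2304 * \<epsilon>"
  shows "\<bar>sqrt (\<kappa> / D) * w - 2 * sqrt \<kappa> * c\<bar> \<le> 3000000 * sqrt \<alpha> * K * \<epsilon>"
proof -
  have r: "0 < sqrt D" "sqrt D * sqrt D = D" using D(1) by simp_all
  \<comment> \<open>A positive multiplier above \<open>1 / 4\<close> turns the difference of square roots into \<open>1 - 4 D\<close>.\<close>
  have "(1 / sqrt D - 2) * (sqrt D + 2 * D) = 1 - 4 * D"
    using r by (simp add: field_simps)
  then have "\<bar>1 / sqrt D - 2\<bar> * (sqrt D + 2 * D) = \<bar>1 - 4 * D\<bar>"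
    using r D(1) abs_mult[of "1 / sqrt D - 2" "sqrt D + 2 * D"] by simp
  moreover have "1 / 4 \<le> sqrt D + 2 * D" using r(1) D(1) by linarith
  then have "\<bar>1 / sqrt D - 2\<bar> * (1 / 4) \<le> \<bar>1 / sqrt D - 2\<bar> * (sqrt D + 2 * D)"
    by (intro mult_left_mono) auto
  moreover have "\<bar>1 - 4 * D\<bar> = 4 * \<bar>D - 1 / 4\<bar>" by (simp add: abs_if)
  ultimately have "\<bar>1 / sqrt D - 2\<bar> \<le> 16 * \<bar>D - 1 / 4\<bar>" by simp
  also have "\<dots> \<le> 16 * (65000 * K * \<epsilon>)" using D(2) by (intro mult_left_mono) auto
  finally have 1: "\<bar>1 / sqrt D - 2\<bar> \<le> 1040000 * K * \<epsilon>" by simp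
  have 2: "\<bar>1 / sqrt D * w - 2 * c\<bar> \<le> 1040000 * K * \<epsilon> * 2 + 2 * (2304 * \<epsilon>)"
    by (rule abs_mult_diff_le[OF 1 w(1) _ w(2)]) simp
  have "1 * \<epsilon> \<le> K * \<epsilon>" using K \<epsilon> by (intro mult_right_mono) auto
  then have 3: "\<bar>1 / sqrt D * w - 2 * c\<bar> \<le> 3000000 * K * \<epsilon>" using 2 by linarith
  have "sqrt (\<kappa> / D) * w - 2 * sqrt \<kappa> * c = sqrt \<kappa> * (1 / sqrt D * w - 2 * c)"
    by (simp add: real_sqrt_divide right_diff_distrib)
  moreover have "\<bar>sqrt \<kappa> * (1 / sqrt D * w - 2 * c)\<bar> \<le> sqrt \<alpha> * (3000000 * K * \<epsilon>)"
    by (intro abs_mult_le 3) (use \<kappa> in simp)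
  ultimately show ?thesis by (simp add: mult_ac)
qed

lemma square_error:
  assumes \<kappa>: "0 \<le> \<kappa>" "\<kappa> \<le> \<alpha>" and K: "1 \<le> K" and \<epsilon>: "0 < \<epsilon>"
    and D: "D \<ge> 1 / 8" "\<bar>D - 1 / 4\<bar> \<le> 65000 * K * \<epsilon>"
    and w: "continuous_on UNIV w" "\<And>x. \<bar>w x\<bar> \<le> 2" "\<And>x. \<bar>w x - cos x\<bar> \<le> 2304 * \<epsilon>"
  shows "\<bar>\<kappa> / D * ((w y)\<^sup>2 - avg (\<lambda>x. (w x)\<^sup>2)) - 2 * \<kappa> * cos (2 * y)\<bar> \<le> 40000000 * \<alpha> * K * \<epsilon>"
proof -
  have le2: "\<bar>cos x\<bar> \<le> 2" for x :: real using abs_cos_le_one[of x] by linarith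
  have 1: "\<bar>(w x)\<^sup>2 - (cos x)\<^sup>2\<bar> \<le> 4 * (2304 * \<epsilon>)" for x by (intro abs_square_diff_le w le2)
  have 2: "\<bar>avg (\<lambda>x. (w x)\<^sup>2) - 1 / 2\<bar> \<le> 4 * (2304 * \<epsilon>)"
    unfolding avg_cos_sq [symmetric] by (intro avg_lipschitz 1 continuous_intros w)
  have "\<bar>(w y)\<^sup>2\<bar> \<le> 4" using abs_mult_le[OF w(2,2), of y y] by (simp add: power2_eq_square)
  then have 3: "\<bar>(w y)\<^sup>2 - avg (\<lambda>x. (w x)\<^sup>2)\<bar> \<le> 8"
    using avg_square_bound[OF w(1,2)] by linarith
  have 4: "\<bar>((w y)\<^sup>2 - avg (\<lambda>x. (w x)\<^sup>2)) - ((cos y)\<^sup>2 - 1 / 2)\<bar> \<le> 8 * (2304 * \<epsilon>)"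
    using 1[of y] 2 by linarith
  have 5: "\<bar>\<kappa> / D - \<kappa> / (1 / 4)\<bar> \<le> \<alpha> * 8 * (65000 * K * \<epsilon> * 8)"
    by (rule abs_divide_diff_le[OF \<kappa> D(1) _ D(2)]) simp
  have 6: "\<bar>\<kappa> / (1 / 4)\<bar> \<le> 4 * \<alpha>" using \<kappa> by simp
  have eq: "\<kappa> / (1 / 4) * ((cos y)\<^sup>2 - 1 / 2) = 2 * \<kappa> * cos (2 * y)"
    unfolding cos_double_cos by (simp add: algebra_simps)
  have "\<bar>\<kappa> / D * ((w y)\<^sup>2 - avg (\<lambda>x. (w x)\<^sup>2)) - 2 * \<kappa> * cos (2 * y)\<bar>
      \<le> \<alpha> * 8 * (65000 * K * \<epsilon> * 8) * 8 + 4 * \<alpha> * (8 * (2304 * \<epsilon>))"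
    using abs_mult_diff_le[OF 5 3 6 4] unfolding eq .
  also have "\<dots> = 33280000 * (\<alpha> * \<epsilon> * K) + 73728 * (\<alpha> * \<epsilon> * 1)" by simp
  also have "\<dots> \<le> 33280000 * (\<alpha> * \<epsilon> * K) + 73728 * (\<alpha> * \<epsilon> * K)"
    using K \<epsilon> \<kappa> by (intro add_left_mono mult_left_mono) auto
  also have "\<dots> = 33353728 * (\<alpha> * \<epsilon> * K)" by simp
  also have "\<dots> \<le> 40000000 * (\<alpha> * \<epsilon> * K)" using K \<epsilon> \<kappa> by (intro mult_right_mono) auto
  finally show ?thesis by (simp add: mult_ac)
qed

theorem lemma2p1:
  fixes \<gamma>\<^sub>0 \<alpha>\<^sub>0 :: real
  assumes "\<gamma>\<^sub>0 > -3" and "\<alpha>\<^sub>0 > 0"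
  shows "\<exists>\<epsilon>\<^sub>0>0. \<exists>C. \<forall>\<epsilon>\<in>{0<..<\<epsilon>\<^sub>0}. \<forall>\<gamma>\<in>{\<gamma>\<^sub>0<..}. \<forall>q\<^sub>0\<in>{-sqrt \<alpha>\<^sub>0<..<sqrt \<alpha>\<^sub>0}.
    \<exists>k\<^sub>c>0. k\<^sub>c\<^sup>2 = 1 + \<epsilon> * q\<^sub>0 \<and>
      (\<forall>x\<^sub>0\<in>{0..<2 * pi / k\<^sub>c}. \<exists>u v.
        stationary_solution (\<epsilon>\<^sup>2 * \<alpha>\<^sub>0) \<gamma> u v \<and>
        (\<forall>x. u (x + 2 * pi / k\<^sub>c) = u x) \<and> (\<forall>x. v (x + 2 * pi / k\<^sub>c) = v x) \<and>
        (\<forall>x. \<bar>u x - 2 * \<epsilon> * sqrt ((\<alpha>\<^sub>0 - q\<^sub>0\<^sup>2) / (3 + \<gamma>)) * cos (k\<^sub>c * (x + x\<^sub>0))\<bar> \<le> C * \<epsilon>\<^sup>2) \<and>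
        (\<forall>x. \<bar>v x - (- 2 * \<epsilon>\<^sup>2 * ((\<alpha>\<^sub>0 - q\<^sub>0\<^sup>2) * \<gamma> / (3 + \<gamma>)) * cos (2 * k\<^sub>c * (x + x\<^sub>0)))\<bar> \<le> C * \<epsilon> ^ 3) \<and>
        (v has_integral 0) {0..2 * pi / k\<^sub>c})"
proof -
  note \<alpha> = assms(2)
  \<comment> \<open>In the scaled problem \<open>\<gamma>\<close> enters only through \<open>s = 1 / (3 + \<gamma>)\<close>, which ranges over the bounded interval up to \<open>S\<close>.\<close>
  define S where "S = 1 / (3 + \<gamma>\<^sub>0)"
  define K where "K = 1 + 3 * S"
  have S: "S > 0" using assms(1) by (simp add: S_def)
  then have K: "K \<ge> 1" by (simp add: K_def)
  note pos = smallness_pos[OF \<alpha> K]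
  from pos have \<epsilon>\<^sub>0: "1 / (2 * smallness \<alpha>\<^sub>0 K) > 0" by simp
  define C1 where "C1 = sqrt S * (3000000 * sqrt \<alpha>\<^sub>0 * K)"
  define C2 where "C2 = K * (40000000 * \<alpha>\<^sub>0 * K)"
  have C: "0 \<le> C1" "0 \<le> C2" using S K \<alpha> by (simp_all add: C1_def C2_def)
  show ?thesis
  proof (rule exI[of _ "1 / (2 * smallness \<alpha>\<^sub>0 K)"],
      rule conjI[OF \<epsilon>\<^sub>0 exI[of _ "C1 + C2"]], intro ballI)
    fix \<epsilon> \<gamma> q\<^sub>0
    assume "\<epsilon> \<in> {0<..<1 / (2 * smallness \<alpha>\<^sub>0 K)}" and \<gamma>: "\<gamma> \<in> {\<gamma>\<^sub>0<..}"
      and q0: "q\<^sub>0 \<in> {-sqrt \<alpha>\<^sub>0<..<sqrt \<alpha>\<^sub>0}"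
    then have \<epsilon>: "\<epsilon> > 0" "\<epsilon> * smallness \<alpha>\<^sub>0 K \<le> 1 / 2" and q: "\<bar>q\<^sub>0\<bar> < sqrt \<alpha>\<^sub>0"
      using pos by (auto simp: field_simps)
    define s where "s = 1 / (3 + \<gamma>)"
    have s: "0 < s" "s \<le> S" using \<gamma> assms(1) by (auto simp: s_def S_def intro!: frac_le)
    have \<gamma>3: "3 + \<gamma> \<noteq> 0" using \<gamma> assms(1) by auto
    define a where "a = 1 - 2 * s"
    define b where "b = 1 - 3 * s"
    have ab: "\<bar>a\<bar> \<le> K" "\<bar>b\<bar> \<le> K" "3 * a / 4 - b / 2 = 1 / 4"
      using s by (auto simp: a_def b_def K_def right_diff_distrib diff_divide_distrib)
    have sa: "(1 + \<gamma>) * s = a" and sb: "\<gamma> * s = b"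
      using \<gamma>3 by (simp_all add: a_def b_def s_def field_simps)
    define \<kappa> where "\<kappa> = \<alpha>\<^sub>0 - q\<^sub>0\<^sup>2"
    have \<kappa>: "0 \<le> \<kappa>" "\<kappa> \<le> \<alpha>\<^sub>0"
      using q \<alpha> abs_le_square_iff[of q\<^sub>0 "sqrt \<alpha>\<^sub>0"] by (auto simp: \<kappa>_def)
    obtain W where W: "W 0 \<in> even_periodic"
      "\<And>j x. j < 4 \<Longrightarrow> (W j has_real_derivative W (Suc j) x) (at x)" "continuous_on UNIV (W 4)"
      "\<And>x. W 0 x + 2 * (1 + \<epsilon> * q\<^sub>0) * W 2 x + (1 + \<epsilon> * q\<^sub>0)\<^sup>2 * W 4 x
        = \<epsilon>\<^sup>2 * reaction \<alpha>\<^sub>0 \<kappa> a b (W 0) x"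
      "\<And>x. \<bar>W 0 x - cos x\<bar> \<le> 2304 * \<epsilon>" "\<And>x. \<bar>W 0 x\<bar> \<le> 2"
      "\<bar>cubic_coeff a b (W 0) - 1 / 4\<bar> \<le> 65000 * K * \<epsilon>" "cubic_coeff a b (W 0) \<ge> 1 / 8"
      using profile_exists[OF \<alpha> K ab \<epsilon> q] unfolding \<kappa>_def by metis
    define D where "D = cubic_coeff a b (W 0)"
    define M where "M = avg (\<lambda>x. (W 0 x)\<^sup>2)"
    define k where "k = sqrt (1 + \<epsilon> * q\<^sub>0)"
    have "\<bar>\<epsilon> * q\<^sub>0\<bar> \<le> \<epsilon> * sqrt \<alpha>\<^sub>0" using q \<epsilon> by (simp add: abs_mult mult_left_mono)
    then have "1 + \<epsilon> * q\<^sub>0 > 0" using eps_sqrt_small[OF \<alpha> K \<epsilon>] by linarith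
    then have k: "k > 0" "k\<^sup>2 = 1 + \<epsilon> * q\<^sub>0" by (simp_all add: k_def)
    \<comment> \<open>The factor \<open>sqrt s\<close> undoes the scaling by \<open>3 + \<gamma>\<close>; \<open>sqrt (\<kappa> / D)\<close> is the amplitude fixed by solvability.\<close>
    define c where "c = \<epsilon> * sqrt s * sqrt (\<kappa> / D)"
    have D0: "0 \<le> \<kappa> / D" using \<kappa> W(8) by (simp add: D_def)
    have c2: "c\<^sup>2 = \<epsilon>\<^sup>2 * s * (\<kappa> / D)"
      using s D0 by (simp add: c_def power_mult_distrib)
    show "\<exists>k\<^sub>c>0. k\<^sub>c\<^sup>2 = 1 + \<epsilon> * q\<^sub>0 \<and>
      (\<forall>x\<^sub>0\<in>{0..<2 * pi / k\<^sub>c}. \<exists>u v.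
        stationary_solution (\<epsilon>\<^sup>2 * \<alpha>\<^sub>0) \<gamma> u v \<and>
        (\<forall>x. u (x + 2 * pi / k\<^sub>c) = u x) \<and> (\<forall>x. v (x + 2 * pi / k\<^sub>c) = v x) \<and>
        (\<forall>x. \<bar>u x - 2 * \<epsilon> * sqrt ((\<alpha>\<^sub>0 - q\<^sub>0\<^sup>2) / (3 + \<gamma>)) * cos (k\<^sub>c * (x + x\<^sub>0))\<bar> \<le> (C1 + C2) * \<epsilon>\<^sup>2) \<and>
        (\<forall>x. \<bar>v x - (- 2 * \<epsilon>\<^sup>2 * ((\<alpha>\<^sub>0 - q\<^sub>0\<^sup>2) * \<gamma> / (3 + \<gamma>)) * cos (2 * k\<^sub>c * (x + x\<^sub>0)))\<bar> \<le> (C1 + C2) * \<epsilon> ^ 3) \<and>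
        (v has_integral 0) {0..2 * pi / k\<^sub>c})"
    proof (intro exI[of _ k] conjI ballI k)
      fix x\<^sub>0 :: real
      define y where "y x = k * (x + x\<^sub>0)" for x
      define u where "u j x = c * k ^ j * W j (y x)" for j x
      define v where "v x = - \<gamma> * ((u 0 x)\<^sup>2 - c\<^sup>2 * M)" for x
      have yper: "y (x + 2 * pi / k) = y x + 2 * pi" for x
        using k by (simp add: y_def field_simps)
      have v: "v x = - (\<epsilon>\<^sup>2 * b) * (\<kappa> / D * ((W 0 (y x))\<^sup>2 - M))" for x
        unfolding v_def u_def sb [symmetric] power_mult_distrib c2 by (simp add: algebra_simps)
      have "stationary_solution (\<epsilon>\<^sup>2 * \<alpha>\<^sub>0) \<gamma> (u 0) v"
        unfolding v_def [abs_def]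
      proof (rule stationary_solutionI)
        fix j x assume "j < (4 :: nat)"
        have "((\<lambda>x. W j (k * (x + x\<^sub>0))) has_real_derivative W (Suc j) (k * (x + x\<^sub>0)) * k) (at x)"
          by (rule DERIV_chain2[OF W(2)[OF \<open>j < 4\<close>]]) (auto intro!: derivative_eq_intros)
        from DERIV_cmult[OF this, of "c * k ^ j"]
        show "(u j has_real_derivative u (Suc j) x) (at x)"
          unfolding u_def [abs_def] y_def by (simp add: mult_ac)
      next
        have "continuous_on UNIV (\<lambda>x. W 4 (k * (x + x\<^sub>0)))"
          by (rule continuous_on_compose2[OF W(3)]) (auto intro!: continuous_intros)
        then show "continuous_on UNIV (u 4)"
          unfolding u_def [abs_def] y_def by (intro continuous_intros)
      next
        fix x
        have k4: "k ^ 4 = (1 + \<epsilon> * q\<^sub>0)\<^sup>2" unfolding k(2) [symmetric] by simp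
        have "u 0 x + 2 * u 2 x + u 4 x
            = c * (W 0 (y x) + 2 * (1 + \<epsilon> * q\<^sub>0) * W 2 (y x) + (1 + \<epsilon> * q\<^sub>0)\<^sup>2 * W 4 (y x))"
          unfolding u_def k4 k(2) by (simp add: algebra_simps)
        also have "\<dots> = c * (\<epsilon>\<^sup>2 * (\<alpha>\<^sub>0 * W 0 (y x)
            + \<kappa> / D * (b * M * W 0 (y x) - a * W 0 (y x) ^ 3)))"
          unfolding W(4) reaction_def cubic_term_def M_def D_def ..
        also have "\<dots> = \<epsilon>\<^sup>2 * \<alpha>\<^sub>0 * u 0 x - \<gamma> * u 0 x * ((u 0 x)\<^sup>2 - c\<^sup>2 * M) - u 0 x ^ 3"
          unfolding u_def sa [symmetric] sb [symmetric] using c2 by simp algebra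
        finally show "u 0 x + 2 * u 2 x + u 4 x
          = \<epsilon>\<^sup>2 * \<alpha>\<^sub>0 * u 0 x - \<gamma> * u 0 x * ((u 0 x)\<^sup>2 - c\<^sup>2 * M) - u 0 x ^ 3" .
      qed
      moreover have "u 0 (x + 2 * pi / k) = u 0 x" for x
        unfolding u_def yper even_periodicD(3)[OF W(1)] ..
      moreover from this have "v (x + 2 * pi / k) = v x" for x by (simp add: v_def)
      moreover have "\<bar>u 0 x - 2 * \<epsilon> * sqrt ((\<alpha>\<^sub>0 - q\<^sub>0\<^sup>2) / (3 + \<gamma>)) * cos (k * (x + x\<^sub>0))\<bar>
          \<le> (C1 + C2) * \<epsilon>\<^sup>2" for x
      proof -
        have "sqrt ((\<alpha>\<^sub>0 - q\<^sub>0\<^sup>2) / (3 + \<gamma>)) = sqrt s * sqrt \<kappa>"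
          by (simp add: s_def \<kappa>_def real_sqrt_divide)
        then have "u 0 x - 2 * \<epsilon> * sqrt ((\<alpha>\<^sub>0 - q\<^sub>0\<^sup>2) / (3 + \<gamma>)) * cos (k * (x + x\<^sub>0))
            = \<epsilon> * (sqrt s * (sqrt (\<kappa> / D) * W 0 (y x) - 2 * sqrt \<kappa> * cos (y x)))"
          by (simp add: u_def c_def y_def algebra_simps)
        also have "\<bar>\<dots>\<bar> \<le> \<epsilon> * (sqrt S * (3000000 * sqrt \<alpha>\<^sub>0 * K * \<epsilon>))"
          unfolding D_def
          by (intro abs_mult_le amplitude_error \<kappa> K \<epsilon> W(5-8)) (use s \<epsilon> in auto)
        also have "\<dots> = C1 * \<epsilon>\<^sup>2" by (simp add: C1_def power2_eq_square)
        also have "\<dots> \<le> (C1 + C2) * \<epsilon>\<^sup>2" using C by (intro mult_right_mono) auto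
        finally show ?thesis .
      qed
      moreover have "\<bar>v x - (- 2 * \<epsilon>\<^sup>2 * ((\<alpha>\<^sub>0 - q\<^sub>0\<^sup>2) * \<gamma> / (3 + \<gamma>)) * cos (2 * k * (x + x\<^sub>0)))\<bar>
          \<le> (C1 + C2) * \<epsilon> ^ 3" for x
      proof -
        have "(\<alpha>\<^sub>0 - q\<^sub>0\<^sup>2) * \<gamma> / (3 + \<gamma>) = \<kappa> * b" by (simp add: sb [symmetric] s_def \<kappa>_def)
        then have "v x - (- 2 * \<epsilon>\<^sup>2 * ((\<alpha>\<^sub>0 - q\<^sub>0\<^sup>2) * \<gamma> / (3 + \<gamma>)) * cos (2 * k * (x + x\<^sub>0)))
            = - \<epsilon>\<^sup>2 * (b * (\<kappa> / D * ((W 0 (y x))\<^sup>2 - M) - 2 * \<kappa> * cos (2 * y x)))"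
          by (simp add: v y_def algebra_simps)
        also have "\<bar>\<dots>\<bar> \<le> \<epsilon>\<^sup>2 * (K * (40000000 * \<alpha>\<^sub>0 * K * \<epsilon>))"
          unfolding D_def M_def
          by (intro abs_mult_le ab square_error \<kappa> K \<epsilon> W(5-8) even_periodicD(1)[OF W(1)]) auto
        also have "\<dots> = C2 * \<epsilon> ^ 3" by (simp add: C2_def power2_eq_square power3_eq_cube)
        also have "\<dots> \<le> (C1 + C2) * \<epsilon> ^ 3" using C \<epsilon> by (intro mult_right_mono) auto
        finally show ?thesis .
      qed
      moreover have "(v has_integral 0) {0..2 * pi / k}"
      proof -
        have "((\<lambda>x. (W 0 (k * (x + x\<^sub>0)))\<^sup>2 - M) has_integral 0) {0..2 * pi / k}"
          unfolding M_def
          by (rule has_integral_over_period[of "\<lambda>x. (W 0 x)\<^sup>2"])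
            (auto intro!: continuous_intros k simp: even_periodicD[OF W(1)])
        from has_integral_mult_right[OF this, of "- (\<epsilon>\<^sup>2 * b) * (\<kappa> / D)"]
        show ?thesis unfolding v [abs_def] y_def by (simp add: mult_ac)
      qed
      ultimately show "\<exists>u v. stationary_solution (\<epsilon>\<^sup>2 * \<alpha>\<^sub>0) \<gamma> u v \<and>
        (\<forall>x. u (x + 2 * pi / k) = u x) \<and> (\<forall>x. v (x + 2 * pi / k) = v x) \<and>
        (\<forall>x. \<bar>u x - 2 * \<epsilon> * sqrt ((\<alpha>\<^sub>0 - q\<^sub>0\<^sup>2) / (3 + \<gamma>)) * cos (k * (x + x\<^sub>0))\<bar> \<le> (C1 + C2) * \<epsilon>\<^sup>2) \<and>
        (\<forall>x. \<bar>v x - (- 2 * \<epsilon>\<^sup>2 * ((\<alpha>\<^sub>0 - q\<^sub>0\<^sup>2) * \<gamma> / (3 + \<gamma>)) * cos (2 * k * (x + x\<^sub>0)))\<bar> \<le> (C1 + C2) * \<epsilon> ^ 3) \<and>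
        (v has_integral 0) {0..2 * pi / k}"
        by (intro exI[of _ "u 0"] exI[of _ v]) blast
    qed
  qed
qed

end
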